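(* Let $H$ be a graded connected Hopf algebra over a field of characteristic zero that is a polynomial algebra with monomial basis $\mathcal{B}$, and let $g_b$ ($b\in\mathcal{B}$) be as defined in the context. For $b\in\mathcal{B}$ with factorization into generators $b=c_1c_2\cdots c_l$, set $$f_b:=\Big(\prod_c a_c(b)!\Big)^{-1}\frac{1}{l!}\sum_{\sigma\in S_l}c^*_{\sigma(1)}c^*_{\sigma(2)}\cdots c^*_{\sigma(l)}\in H^*.$$ Then for every positive integer $a$, $f_b$ is an eigenvector of $\Psi^{*a}$ of eigenvalue $a^l$; for each $b'\in\mathcal{B}$, $f_b(b')$ equals $\big(\prod_c a_c(b)!\big)^{-1}\frac{1}{l!}$ times the sum over $\sigma\in S_l$ of the coefficients of $c_{\sigma(1)}\otimes c_{\sigma(2)}\otimes\cdots\otimes c_{\sigma(l)}$ in $\Delta^{[l]}(b')$; and $f_b$ satisfies $$f_b=b^*+\sum_{b'\in\mathcal{B},\ b'\to b,\ b'\neq b}f_b(b')\,b'^*=b^*+\sum_{b'\in\mathcal{B},\ l(b')<l(b)}f_b(b')\,b'^*.$$ Furthermore $\{f_b\}$ is the dual basis to $\{g_b\}$: $f_b(g_{b'})=0$ if $b\neq b'$ and $f_b(g_b)=1$.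
   Context: Graded connected Hopf algebra $H=\bigoplus_n H_n$ ($H_0$ the field, $H_n$ finite-dimensional, structure maps graded, counit zero in positive degree). $m^{[a]}$, $\Delta^{[a]}$ are $a$-fold product and coproduct ($\Delta^{[1]}=\mathrm{id}$, $\Delta^{[a]}=(\mathrm{id}^{\otimes(a-2)}\otimes\Delta)\Delta^{[a-1]}$), $\Psi^a=m^{[a]}\Delta^{[a]}$. "Polynomial algebra with monomial basis $\mathcal{B}$": $H=k[c_1,c_2,\dots]$ as an algebra, on homogeneous generators $c_i$ of positive degree, $\mathcal{B}$ the monomials. $l(b)$ is the number of generator factors of $b$; $a_c(b)$ is the number of factors of $b$ equal to the generator $c$. $b'\to b$ means $b$ has nonzero coefficient in $\Psi^a(b')$ for some positive integer $a$. $H^*=\bigoplus_n H_n^*$ is the graded dual, with product $(x^*y^* )(z)=(x^*\otimes y^* )(\Delta z)$; $\{b^*\}$ is the basis dual to $\mathcal{B}$; for $f\in H^*$, $f(b')$ is its value at $b'$, so $f=\sum_{b'}f(b')b'^*$. $\Psi^{*a}:H^*\to H^*$ is the dual map of $\Psi^a$: $(\Psi^{*a}f)(z)=f(\Psi^a z)$. The elements $g_b$: let $\bar\Delta(x)=\Delta(x)-1\otimes x-x\otimes1$, $\bar\Delta^{[1]}=\mathrm{id}$, $\bar\Delta^{[a]}=(\mathrm{id}^{\otimes(a-2)}\otimes\bar\Delta)\bar\Delta^{[a-1]}$, $e(x)=\sum_{a\ge1}\frac{(-1)^{a-1}}{a}m^{[a]}\bar\Delta^{[a]}(x)$; for $b=c_1\cdots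 c_l$, $g_b=e(c_1)\cdots e(c_l)$. *)

theory Defs
  imports
    Complex_Main
    "HOL-Library.Multiset"
    "HOL-Library.Poly_Mapping"
    "HOL-Library.Product_Plus"
    "HOL-Library.Function_Algebras"
    "HOL-Combinatorics.Permutations"
begin

text \<open>
  A finitely supported function \<open>'m \<Rightarrow>\<^sub>0 'k\<close> is an element of the \<open>'k\<close>-vector space with
  basis \<open>'m\<close>. Tensor products are taken in coordinates: the tensor product of the spaces
  with bases \<open>'m\<close> and \<open>'n\<close> is the space with basis \<open>'m \<times> 'n\<close>, and the \<open>a\<close>-th tensor power
  of the space with basis \<open>'m\<close> lives inside \<open>'m list \<Rightarrow>\<^sub>0 'k\<close>, spanned by the lists of
  length \<open>a\<close>; the list \<open>[m1, ..., ma]\<close> stands for \<open>m1 \<otimes> ... \<otimes> ma\<close>.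
\<close>

definition scale :: "'k::field \<Rightarrow> ('m \<Rightarrow>\<^sub>0 'k) \<Rightarrow> ('m \<Rightarrow>\<^sub>0 'k)" where
  "scale a x = Poly_Mapping.map ((*) a) x"

lemma lookup_scale [simp]:
  "Poly_Mapping.lookup (scale a x) m = a * Poly_Mapping.lookup x m"
  by (simp add: scale_def Poly_Mapping.map.rep_eq when_def)

interpretation pm: vector_space "scale :: 'k::field \<Rightarrow> ('m \<Rightarrow>\<^sub>0 'k) \<Rightarrow> _"
  by unfold_locales (auto intro!: poly_mapping_eqI simp: lookup_add algebra_simps)

definition mon :: "'m \<Rightarrow> ('m \<Rightarrow>\<^sub>0 'k::field)" where
  "mon m = Poly_Mapping.single m 1"

definition lin_ext :: "('m \<Rightarrow> ('n \<Rightarrow>\<^sub>0 'k)) \<Rightarrow> ('m \<Rightarrow>\<^sub>0 'k::field) \<Rightarrow> ('n \<Rightarrow>\<^sub>0 'k)" where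
  "lin_ext \<phi> x = (\<Sum>m\<in>Poly_Mapping.keys x. scale (Poly_Mapping.lookup x m) (\<phi> m))"

definition tensor :: "('m \<Rightarrow>\<^sub>0 'k::field) \<Rightarrow> ('n \<Rightarrow>\<^sub>0 'k) \<Rightarrow> ('m \<times> 'n \<Rightarrow>\<^sub>0 'k)" where
  "tensor x y = lin_ext (\<lambda>m. lin_ext (\<lambda>n. mon (m, n)) y) x"

definition tensor_map ::
  "(('m \<Rightarrow>\<^sub>0 'k) \<Rightarrow> ('m' \<Rightarrow>\<^sub>0 'k)) \<Rightarrow> (('n \<Rightarrow>\<^sub>0 'k) \<Rightarrow> ('n' \<Rightarrow>\<^sub>0 'k))
    \<Rightarrow> ('m \<times> 'n \<Rightarrow>\<^sub>0 'k::field) \<Rightarrow> ('m' \<times> 'n' \<Rightarrow>\<^sub>0 'k)" where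
  "tensor_map f g = lin_ext (\<lambda>(m, n). tensor (f (mon m)) (g (mon n)))"

definition tensor_assoc :: "(('l \<times> 'm) \<times> 'n \<Rightarrow>\<^sub>0 'k::field) \<Rightarrow> ('l \<times> ('m \<times> 'n) \<Rightarrow>\<^sub>0 'k)" where
  "tensor_assoc = lin_ext (\<lambda>((l, m), n). mon (l, (m, n)))"

text \<open>
  Monomials in generators \<open>'g\<close> are multisets of generators; the convolution product of
  \<open>Poly_Mapping\<close> makes \<open>'g multiset \<Rightarrow>\<^sub>0 'k\<close> the polynomial algebra \<open>k[c : c \<in> 'g]\<close>, and
  makes the type \<open>('g, 'k) pol2\<close> the tensor product of this algebra with itself.
\<close>

type_synonym ('g, 'k) pol = "'g multiset \<Rightarrow>\<^sub>0 'k"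
type_synonym ('g, 'k) pol2 = "'g multiset \<times> 'g multiset \<Rightarrow>\<^sub>0 'k"

definition wt :: "('g \<Rightarrow> nat) \<Rightarrow> 'g multiset \<Rightarrow> nat" where
  "wt deg m = (\<Sum>c\<in>#m. deg c)"

definition homog :: "('g \<Rightarrow> nat) \<Rightarrow> nat \<Rightarrow> ('g, 'k::field) pol set" where
  "homog deg n = {x. \<forall>m\<in>Poly_Mapping.keys x. wt deg m = n}"

definition homog2 :: "('g \<Rightarrow> nat) \<Rightarrow> nat \<Rightarrow> ('g, 'k::field) pol2 set" where
  "homog2 deg n = {t. \<forall>(p, q)\<in>Poly_Mapping.keys t. wt deg p + wt deg q = n}"

definition mult2 :: "('g, 'k::field) pol2 \<Rightarrow> ('g, 'k) pol" where
  "mult2 = lin_ext (\<lambda>(p, q). mon p * mon q)"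

text \<open>
  The product and unit of the polynomial algebra respect the grading automatically, and
  positivity of the degrees of the generators makes the degree zero part the base field.
\<close>

locale graded_connected_polynomial_hopf =
  fixes deg :: "'g \<Rightarrow> nat"
    and \<Delta> :: "('g, 'k::field) pol \<Rightarrow> ('g, 'k) pol2"
    and \<epsilon> :: "('g, 'k) pol \<Rightarrow> 'k"
    and antipode :: "('g, 'k) pol \<Rightarrow> ('g, 'k) pol"
  assumes deg_pos: "deg c > 0"
    and finite_dim: "\<exists>B. finite B \<and> (homog deg n :: ('g, 'k) pol set) \<subseteq> pm.span B"
    and linear_comult: "Vector_Spaces.linear scale scale \<Delta>"
    and linear_counit: "Vector_Spaces.linear scale (*) \<epsilon>"
    and linear_antipode: "Vector_Spaces.linear scale scale antipode"
    and coassoc: "tensor_assoc (tensor_map \<Delta> id (\<Delta> x)) = tensor_map id \<Delta> (\<Delta> x)"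
    and counit_left: "lin_ext (\<lambda>(p, q). scale (\<epsilon> (mon p)) (mon q)) (\<Delta> x) = x"
    and counit_right: "lin_ext (\<lambda>(p, q). scale (\<epsilon> (mon q)) (mon p)) (\<Delta> x) = x"
    and comult_mult: "\<Delta> (x * y) = \<Delta> x * \<Delta> y"
    and comult_one: "\<Delta> 1 = 1"
    and counit_mult: "\<epsilon> (x * y) = \<epsilon> x * \<epsilon> y"
    and counit_one: "\<epsilon> 1 = 1"
    and antipode_left: "mult2 (tensor_map antipode id (\<Delta> x)) = scale (\<epsilon> x) 1"
    and antipode_right: "mult2 (tensor_map id antipode (\<Delta> x)) = scale (\<epsilon> x) 1"
    and comult_graded: "x \<in> homog deg n \<Longrightarrow> \<Delta> x \<in> homog2 deg n"
    and counit_graded: "x \<in> homog deg n \<Longrightarrow> n > 0 \<Longrightarrow> \<epsilon> x = 0"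
    and antipode_graded: "x \<in> homog deg n \<Longrightarrow> antipode x \<in> homog deg n"

text \<open>
  \<open>iter_comult \<epsilon> D a\<close> is the \<open>a\<close>-fold iterate of a comultiplication \<open>D\<close>, always applying
  \<open>D\<close> to the last tensor factor. For \<open>a = 0\<close> it is the counit, with values in the zeroth
  tensor power (spanned by the empty list).
\<close>

fun iter_comult ::
  "(('g, 'k::field) pol \<Rightarrow> 'k) \<Rightarrow> (('g, 'k) pol \<Rightarrow> ('g, 'k) pol2)
    \<Rightarrow> nat \<Rightarrow> ('g, 'k) pol \<Rightarrow> ('g multiset list \<Rightarrow>\<^sub>0 'k)" where
  "iter_comult \<epsilon> D 0 x = scale (\<epsilon> x) (mon [])"
| "iter_comult \<epsilon> D (Suc 0) x = lin_ext (\<lambda>m. mon [m]) x"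
| "iter_comult \<epsilon> D (Suc (Suc a)) x =
     lin_ext (\<lambda>ms. lin_ext (\<lambda>(p, q). mon (butlast ms @ [p, q])) (D (mon (last ms))))
       (iter_comult \<epsilon> D (Suc a) x)"

text \<open>All iterated products at once: the \<open>a\<close>-fold product on lists of length \<open>a\<close>.\<close>

definition iter_mult :: "('g multiset list \<Rightarrow>\<^sub>0 'k::field) \<Rightarrow> ('g, 'k) pol" where
  "iter_mult = lin_ext (\<lambda>ms. prod_list (map mon ms))"

definition Psi ::
  "(('g, 'k::field) pol \<Rightarrow> 'k) \<Rightarrow> (('g, 'k) pol \<Rightarrow> ('g, 'k) pol2)
    \<Rightarrow> nat \<Rightarrow> ('g, 'k) pol \<Rightarrow> ('g, 'k) pol" where
  "Psi \<epsilon> \<Delta> a x = iter_mult (iter_comult \<epsilon> \<Delta> a x)"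

text \<open>\<open>arrow \<epsilon> \<Delta> b' b\<close> is the relation \<open>b' \<rightarrow> b\<close>.\<close>

definition arrow ::
  "(('g, 'k::field) pol \<Rightarrow> 'k) \<Rightarrow> (('g, 'k) pol \<Rightarrow> ('g, 'k) pol2)
    \<Rightarrow> 'g multiset \<Rightarrow> 'g multiset \<Rightarrow> bool" where
  "arrow \<epsilon> \<Delta> b' b \<longleftrightarrow> (\<exists>a>0. Poly_Mapping.lookup (Psi \<epsilon> \<Delta> a (mon b')) b \<noteq> 0)"

definition reduced_comult ::
  "(('g, 'k::field) pol \<Rightarrow> ('g, 'k) pol2) \<Rightarrow> ('g, 'k) pol \<Rightarrow> ('g, 'k) pol2" where
  "reduced_comult \<Delta> x = \<Delta> x - tensor 1 x - tensor x 1"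

text \<open>
  The sum over \<open>a \<ge> 1\<close> is indexed by \<open>n = a - 1\<close>. It is \<open>Sum_any\<close>, the sum of the nonzero
  terms, of which there are finitely many when \<open>x\<close> has zero constant term.
\<close>

definition euler ::
  "(('g, 'k::field_char_0) pol \<Rightarrow> 'k) \<Rightarrow> (('g, 'k) pol \<Rightarrow> ('g, 'k) pol2)
    \<Rightarrow> ('g, 'k) pol \<Rightarrow> ('g, 'k) pol" where
  "euler \<epsilon> \<Delta> x =
     Sum_any (\<lambda>n. scale ((- 1) ^ n / of_nat (Suc n))
       (iter_mult (iter_comult \<epsilon> (reduced_comult \<Delta>) (Suc n) x)))"

definition g_elt ::
  "(('g, 'k::field_char_0) pol \<Rightarrow> 'k) \<Rightarrow> (('g, 'k) pol \<Rightarrow> ('g, 'k) pol2)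
    \<Rightarrow> 'g multiset \<Rightarrow> ('g, 'k) pol" where
  "g_elt \<epsilon> \<Delta> b = (\<Prod>c\<in>#b. euler \<epsilon> \<Delta> (mon {#c#}))"

definition fscale :: "'k::field \<Rightarrow> ('x \<Rightarrow> 'k) \<Rightarrow> ('x \<Rightarrow> 'k)" where
  "fscale a f = (\<lambda>x. a * f x)"

interpretation fn: vector_space "fscale :: 'k::field \<Rightarrow> ('x \<Rightarrow> 'k) \<Rightarrow> _"
  by unfold_locales (auto simp: fscale_def fun_eq_iff algebra_simps)

definition graded_dual :: "('g \<Rightarrow> nat) \<Rightarrow> (('g, 'k::field) pol \<Rightarrow> 'k) set" where
  "graded_dual deg =
     {f. Vector_Spaces.linear scale (*) f \<and> finite {n. \<exists>x\<in>homog deg n. f x \<noteq> 0}}"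

definition dual :: "'g multiset \<Rightarrow> ('g, 'k::field) pol \<Rightarrow> 'k" where
  "dual b = (\<lambda>x. Poly_Mapping.lookup x b)"

definition dual_tensor ::
  "(('g, 'k::field) pol \<Rightarrow> 'k) \<Rightarrow> (('g, 'k) pol \<Rightarrow> 'k) \<Rightarrow> ('g, 'k) pol2 \<Rightarrow> 'k" where
  "dual_tensor f g t =
     (\<Sum>(p, q)\<in>Poly_Mapping.keys t. Poly_Mapping.lookup t (p, q) * (f (mon p) * g (mon q)))"

definition dual_mult ::
  "(('g, 'k::field) pol \<Rightarrow> ('g, 'k) pol2) \<Rightarrow> (('g, 'k) pol \<Rightarrow> 'k) \<Rightarrow> (('g, 'k) pol \<Rightarrow> 'k)
    \<Rightarrow> (('g, 'k) pol \<Rightarrow> 'k)" where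
  "dual_mult \<Delta> f g = (\<lambda>z. dual_tensor f g (\<Delta> z))"

text \<open>The counit is the unit of the graded dual, hence the value of the empty product.\<close>

definition dual_prod ::
  "(('g, 'k::field) pol \<Rightarrow> 'k) \<Rightarrow> (('g, 'k) pol \<Rightarrow> ('g, 'k) pol2)
    \<Rightarrow> (('g, 'k) pol \<Rightarrow> 'k) list \<Rightarrow> (('g, 'k) pol \<Rightarrow> 'k)" where
  "dual_prod \<epsilon> \<Delta> fs = foldr (dual_mult \<Delta>) fs \<epsilon>"

definition Psi_dual ::
  "(('g, 'k::field) pol \<Rightarrow> 'k) \<Rightarrow> (('g, 'k) pol \<Rightarrow> ('g, 'k) pol2)
    \<Rightarrow> nat \<Rightarrow> (('g, 'k) pol \<Rightarrow> 'k) \<Rightarrow> (('g, 'k) pol \<Rightarrow> 'k)" where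
  "Psi_dual \<epsilon> \<Delta> a f = (\<lambda>z. f (Psi \<epsilon> \<Delta> a z))"

definition f_coeff :: "'g multiset \<Rightarrow> 'k::field_char_0" where
  "f_coeff b = inverse (\<Prod>c\<in>set_mset b. fact (count b c)) * (1 / fact (size b))"

text \<open>
  \<open>cs = [c1, ..., cl]\<close> lists the factors of the monomial \<open>b = mset cs\<close>; the symmetric group
  acts on the positions \<open>0, ..., l - 1\<close>.
\<close>

definition f_elt ::
  "(('g, 'k::field_char_0) pol \<Rightarrow> 'k) \<Rightarrow> (('g, 'k) pol \<Rightarrow> ('g, 'k) pol2)
    \<Rightarrow> 'g list \<Rightarrow> (('g, 'k) pol \<Rightarrow> 'k)" where
  "f_elt \<epsilon> \<Delta> cs =
     fscale (f_coeff (mset cs))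
       (\<Sum>\<sigma> | \<sigma> permutes {..<length cs}.
          dual_prod \<epsilon> \<Delta> (map (\<lambda>i. dual {#cs ! \<sigma> i#}) [0..<length cs]))"

end

theory Submission
  imports Defs "HOL-Combinatorics.Multiset_Permutations" "HOL-Computational_Algebra.Polynomial"
begin

text \<open>
  Let \<open>\<xi>\<close> be the projection of \<open>H\<close> onto the span of the generators and \<open>\<xi>\<^sup>n\<close> its convolution powers
  with values in the polynomial algebra \<open>H\<close> itself. Collecting the words in the generators by their
  underlying monomial shows that \<open>f\<^sub>b\<close> is \<open>1 / l!\<close> times the \<open>b\<close>-coefficient of \<open>\<xi>\<^sup>l\<close>, \<open>l = l(b)\<close>. As \<open>\<xi>\<close>
  kills products of elements of positive degree, the powers obey the Leibniz rule
  \<open>\<xi>\<^sup>n(xy) = \<Sum>\<^sub>k (n choose k) \<xi>\<^sup>k(x) \<xi>\<^sup>n\<^sup>-\<^sup>k(y)\<close>. It gives \<open>\<xi>\<^sup>n(\<Psi>\<^sup>a z) = a\<^sup>n \<xi>\<^sup>n(z)\<close>, hence the eigenvector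
  property, and \<open>\<xi>\<^sup>n(b) = 0\<close> for \<open>n < l(b)\<close>, \<open>\<xi>\<^sup>l(b) = l! b\<close>, hence triangularity. Applied to the terms
  of the logarithm \<open>e\<close>, it turns \<open>\<xi>\<^sup>l(e(c))\<close> into a Newton series for the derivative of \<open>x\<^sup>l\<close> at \<open>0\<close>, so
  \<open>\<xi>\<^sup>l(e(c))\<close> is \<open>c\<close> for \<open>l = 1\<close> and \<open>0\<close> otherwise; by the Leibniz rule again \<open>\<xi>\<^sup>n(g\<^sub>b)\<close> is \<open>l! b\<close> for
  \<open>n = l(b)\<close> and \<open>0\<close> otherwise, which is the duality.
\<close>

section \<open>Linear extension\<close>

text \<open>Cancellation can shrink the support of a sum, so identities between several elements are
  summed over one common finite index set.\<close>

lemma lin_ext_superset: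
  assumes "finite A" "Poly_Mapping.keys x \<subseteq> A"
  shows "lin_ext \<phi> x = (\<Sum>m\<in>A. scale (Poly_Mapping.lookup x m) (\<phi> m))"
  unfolding lin_ext_def using assms
  by (intro sum.mono_neutral_left) (auto simp: in_keys_iff)

lemma lookup_lin_ext:
  "Poly_Mapping.lookup (lin_ext \<phi> x) b =
     (\<Sum>m\<in>Poly_Mapping.keys x. Poly_Mapping.lookup x m * Poly_Mapping.lookup (\<phi> m) b)"
  by (simp add: lin_ext_def lookup_sum)

lemma lin_ext_add: "lin_ext \<phi> (x + y) = lin_ext \<phi> x + lin_ext \<phi> y"
proof -
  let ?A = "Poly_Mapping.keys x \<union> Poly_Mapping.keys y"
  have "Poly_Mapping.keys (x + y) \<subseteq> ?A" by (rule Poly_Mapping.keys_add)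
  then show ?thesis
    by (simp add: lin_ext_superset[of ?A] lookup_add pm.scale_left_distrib sum.distrib)
qed

lemma lin_ext_scale: "lin_ext \<phi> (scale a x) = scale a (lin_ext \<phi> x)"
proof -
  have "Poly_Mapping.keys (scale a x) \<subseteq> Poly_Mapping.keys x" by (auto simp: in_keys_iff)
  then show ?thesis
    by (simp add: lin_ext_superset[of "Poly_Mapping.keys x"] pm.scale_sum_right)
qed

lemma linear_lin_ext [simp]: "Vector_Spaces.linear scale scale (lin_ext \<phi>)"
  by unfold_locales (simp_all add: lin_ext_add lin_ext_scale)

lemma lin_ext_mon [simp]: "lin_ext \<phi> (mon m) = \<phi> m"
  by (simp add: lin_ext_def mon_def)

lemma lin_ext_mon_ident [simp]: "lin_ext mon x = x"
proof (rule poly_mapping_eqI)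
  fix k
  have "(\<Sum>m\<in>Poly_Mapping.keys x. Poly_Mapping.lookup x m * (1 when m = k))
      = (\<Sum>m\<in>Poly_Mapping.keys x. if m = k then Poly_Mapping.lookup x m else 0)"
    by (intro sum.cong) auto
  then show "Poly_Mapping.lookup (lin_ext mon x) k = Poly_Mapping.lookup x k"
    by (simp add: lookup_lin_ext mon_def lookup_single in_keys_iff)
qed

lemma expand_mon: "x = (\<Sum>m\<in>Poly_Mapping.keys x. scale (Poly_Mapping.lookup x m) (mon m))"
  using lin_ext_mon_ident[of x] by (simp add: lin_ext_def)

lemma linear_comp_lin_ext:
  assumes "Vector_Spaces.linear scale scale f"
  shows "f (lin_ext \<phi> x) = lin_ext (\<lambda>m. f (\<phi> m)) x"
proof -
  interpret Vector_Spaces.linear scale scale f by fact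
  show ?thesis by (simp add: lin_ext_def sum scale)
qed

lemma linear_eq_lin_ext:
  assumes "Vector_Spaces.linear scale scale f"
  shows "f x = lin_ext (\<lambda>m. f (mon m)) x"
  using linear_comp_lin_ext[OF assms, of mon x] by simp

lemma lin_ext_lin_ext: "lin_ext \<psi> (lin_ext \<phi> x) = lin_ext (\<lambda>m. lin_ext \<psi> (\<phi> m)) x"
  by (rule linear_comp_lin_ext) simp

lemma lin_ext_cong:
  "(\<And>m. m \<in> Poly_Mapping.keys x \<Longrightarrow> \<phi> m = \<psi> m) \<Longrightarrow> lin_ext \<phi> x = lin_ext \<psi> x"
  unfolding lin_ext_def by (intro sum.cong) auto

lemma lin_ext_zero_fun [simp]: "lin_ext (\<lambda>_. 0) x = 0"
  by (simp add: lin_ext_def)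

lemma lin_ext_add_fun: "lin_ext (\<lambda>m. \<phi> m + \<psi> m) x = lin_ext \<phi> x + lin_ext \<psi> x"
  by (simp add: lin_ext_def pm.scale_right_distrib sum.distrib)

lemma lin_ext_scale_fun: "lin_ext (\<lambda>m. scale a (\<phi> m)) x = scale a (lin_ext \<phi> x)"
  by (simp add: lin_ext_def pm.scale_sum_right mult.commute)

lemma lin_ext_sum_fun: "lin_ext (\<lambda>m. \<Sum>i\<in>I. \<phi> i m) x = (\<Sum>i\<in>I. lin_ext (\<phi> i) x)"
  unfolding lin_ext_def pm.scale_sum_right by (rule sum.swap)

lemma keys_mon [simp]: "Poly_Mapping.keys (mon m :: _ \<Rightarrow>\<^sub>0 'k::field) = {m}"
  by (simp add: mon_def)

lemma lookup_mon: "Poly_Mapping.lookup (mon m) n = (if m = n then 1 else 0)"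
  by (simp add: mon_def lookup_single when_def)

lemma mon_mult: "mon m * mon n = mon (m + n)"
  by (simp add: mon_def mult_single)

lemma mon_zero: "mon 0 = 1"
  by (simp add: mon_def)

text \<open>Scalars become constants of the algebra, so that ring laws move them through
  products.\<close>

lemma scale_eq_single_mult:
  fixes x :: "'m::monoid_add \<Rightarrow>\<^sub>0 'k::field"
  shows "scale a x = Poly_Mapping.single 0 a * x"
proof -
  have "scale v (mon m) = Poly_Mapping.single m v" for v :: 'k and m :: 'm
    by (auto intro!: poly_mapping_eqI simp: lookup_mon lookup_single when_def)
  then have e: "x = (\<Sum>m\<in>Poly_Mapping.keys x. Poly_Mapping.single m (Poly_Mapping.lookup x m))"
    using expand_mon[of x] by simp
  have "scale a (Poly_Mapping.single m v) = Poly_Mapping.single 0 a * Poly_Mapping.single m v" for v and m :: 'm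
    by (auto intro!: poly_mapping_eqI simp: mult_single lookup_single when_def)
  then show ?thesis
    by (subst (1 2) e) (simp add: pm.scale_sum_right sum_distrib_left)
qed

lemma scale_mult_left: "scale a x * y = scale a (x * y)"
  for x y :: "'m::comm_monoid_add \<Rightarrow>\<^sub>0 'k::field"
  by (simp add: scale_eq_single_mult mult.assoc)

lemma scale_mult_right: "x * scale a y = scale a (x * y)"
  for x y :: "'m::comm_monoid_add \<Rightarrow>\<^sub>0 'k::field"
  by (simp add: scale_eq_single_mult mult.left_commute)

lemma lin_ext_mult_left: "lin_ext \<phi> x * y = lin_ext (\<lambda>m. \<phi> m * y) x"
  for y :: "'m::comm_monoid_add \<Rightarrow>\<^sub>0 'k::field"
  by (simp add: lin_ext_def sum_distrib_right scale_mult_left)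

lemma lin_ext_mult_right: "y * lin_ext \<phi> x = lin_ext (\<lambda>m. y * \<phi> m) x"
  for y :: "'m::comm_monoid_add \<Rightarrow>\<^sub>0 'k::field"
  by (simp add: lin_ext_def sum_distrib_left scale_mult_right)

text \<open>Needed for \<open>\<Delta> x * \<Delta> y\<close>: a linear map on this product becomes
  a double sum over the terms of the two coproducts.\<close>

lemma lin_ext_of_mult:
  "lin_ext \<psi> (s * t) = lin_ext (\<lambda>m. lin_ext (\<lambda>n. \<psi> (m + n)) t) s"
  for s t :: "'m::comm_monoid_add \<Rightarrow>\<^sub>0 'k::field"
proof -
  have "s * t = lin_ext mon s * lin_ext mon t" by simp
  also have "\<dots> = lin_ext (\<lambda>m. lin_ext (\<lambda>n. mon (m + n)) t) s"
    by (subst lin_ext_mult_left, subst lin_ext_mult_right) (simp only: mon_mult)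
  finally have e: "s * t = lin_ext (\<lambda>m. lin_ext (\<lambda>n. mon (m + n)) t) s" .
  show ?thesis unfolding e lin_ext_lin_ext lin_ext_mon ..
qed

lemma keys_lin_ext:
  assumes "b \<in> Poly_Mapping.keys (lin_ext \<phi> x)"
  obtains m where "m \<in> Poly_Mapping.keys x" "b \<in> Poly_Mapping.keys (\<phi> m)"
proof -
  have "\<exists>m\<in>Poly_Mapping.keys x. Poly_Mapping.lookup (\<phi> m) b \<noteq> 0"
  proof (rule ccontr)
    assume "\<not> ?thesis"
    then have "Poly_Mapping.lookup (lin_ext \<phi> x) b = 0" by (simp add: lookup_lin_ext)
    then show False using assms by (simp add: in_keys_iff)
  qed
  then show ?thesis using that by (auto simp: in_keys_iff)
qed

lemma lookup_mon_mult:
  "Poly_Mapping.lookup (mon p * x) b = (if p \<subseteq># b then Poly_Mapping.lookup x (b - p) else 0)"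
  for x :: "('g, 'k::field) pol"
proof -
  have "mon p * x = lin_ext (\<lambda>m. mon (p + m)) x"
    using lin_ext_mult_right[of "mon p" mon x] by (simp add: mon_mult)
  then have "Poly_Mapping.lookup (mon p * x) b =
      (\<Sum>m\<in>Poly_Mapping.keys x. Poly_Mapping.lookup x m * (if p + m = b then 1 else 0))"
    by (simp add: lookup_lin_ext lookup_mon)
  \<comment> \<open>Multisets cancel, so \<open>p + m = b\<close> forces \<open>m = b - p\<close>;
    the truncated difference is a solution only if \<open>p \<subseteq># b\<close>.\<close>
  also have "\<dots> = (\<Sum>m\<in>Poly_Mapping.keys x.
      if m = b - p then (if p \<subseteq># b then Poly_Mapping.lookup x m else 0) else 0)"
    by (intro sum.cong) (auto simp: subset_mset.add_diff_inverse)
  also have "\<dots> = (if p \<subseteq># b then Poly_Mapping.lookup x (b - p) else 0)"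
    by (auto simp: in_keys_iff)
  finally show ?thesis .
qed

section \<open>Iterated coproducts\<close>

lemma length_keys_iter_comult:
  "ms \<in> Poly_Mapping.keys (iter_comult e D a z) \<Longrightarrow> length ms = a"
proof (induction e D a z arbitrary: ms rule: iter_comult.induct)
  case (1 e D x)
  then show ?case by (auto simp: in_keys_iff lookup_mon split: if_splits)
next
  case (2 e D x)
  then show ?case by (auto elim!: keys_lin_ext)
next
  case (3 e D a x)
  from "3.prems" obtain ns where ns: "ns \<in> Poly_Mapping.keys (iter_comult e D (Suc a) x)"
    and "ms \<in> Poly_Mapping.keys (lin_ext (\<lambda>(p, q). mon (butlast ns @ [p, q])) (D (mon (last ns))))"
    by (auto elim: keys_lin_ext)
  moreover from "3.IH"[OF ns] have "length ns = Suc a" .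
  ultimately show ?case by (auto elim!: keys_lin_ext)
qed

text \<open>Peels off the first tensor factor instead of the last one. The factors are kept in order, so this
  needs no coassociativity.\<close>

lemma iter_comult_Suc_Suc:
  assumes D: "Vector_Spaces.linear scale scale D"
  shows "iter_comult e D (Suc (Suc a)) z =
    lin_ext (\<lambda>(p, q). lin_ext (\<lambda>ms. mon (p # ms)) (iter_comult e D (Suc a) (mon q))) (D z)"
proof (induction a)
  case 0
  have "iter_comult e D (Suc (Suc 0)) z = lin_ext (\<lambda>m. lin_ext (\<lambda>(p, q). mon [p, q]) (D (mon m))) z"
    by (simp add: lin_ext_lin_ext)
  also have "\<dots> = lin_ext (\<lambda>(p, q). mon [p, q]) (lin_ext (\<lambda>m. D (mon m)) z)"
    by (simp add: lin_ext_lin_ext)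
  also have "lin_ext (\<lambda>m. D (mon m)) z = D z"
    by (rule linear_eq_lin_ext[OF D, symmetric])
  finally show ?case by (simp add: case_prod_unfold)
next
  case (Suc a)
  define G where
    "G = (\<lambda>ms. lin_ext (\<lambda>(p, q). mon (butlast ms @ [p, q])) (D (mon (last ms))))"
  have it: "iter_comult e D (Suc (Suc b)) x = lin_ext G (iter_comult e D (Suc b) x)" for b x
    by (simp add: G_def)
  \<comment> \<open>\<open>G\<close> touches only the last entry, so it commutes with prepending
    \<open>p\<close>. For an empty list it would act on \<open>p\<close> itself.\<close>
  have G_Cons: "G (p # ms) = lin_ext (\<lambda>ns. mon (p # ns)) (G ms)" if "ms \<noteq> []" for p ms
    using that by (simp add: G_def lin_ext_lin_ext case_prod_unfold)
  have "lin_ext (\<lambda>ms. G (p # ms)) (iter_comult e D (Suc a) (mon q))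
      = lin_ext (\<lambda>ms. lin_ext (\<lambda>ns. mon (p # ns)) (G ms)) (iter_comult e D (Suc a) (mon q))" for p q
  proof (rule lin_ext_cong)
    fix ms assume "ms \<in> Poly_Mapping.keys (iter_comult e D (Suc a) (mon q))"
    from length_keys_iter_comult[OF this] have "ms \<noteq> []" by auto
    then show "G (p # ms) = lin_ext (\<lambda>ns. mon (p # ns)) (G ms)" by (rule G_Cons)
  qed
  then have step: "lin_ext (\<lambda>ms. G (p # ms)) (iter_comult e D (Suc a) (mon q))
      = lin_ext (\<lambda>ns. mon (p # ns)) (iter_comult e D (Suc (Suc a)) (mon q))" for p q
    by (simp only: it lin_ext_lin_ext)
  have "iter_comult e D (Suc (Suc (Suc a))) z
      = lin_ext G (lin_ext (\<lambda>(p, q). lin_ext (\<lambda>ms. mon (p # ms)) (iter_comult e D (Suc a) (mon q))) (D z))"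
    unfolding it[of "Suc a"] Suc.IH ..
  also have "\<dots> = lin_ext (\<lambda>(p, q). lin_ext (\<lambda>ms. G (p # ms)) (iter_comult e D (Suc a) (mon q))) (D z)"
    by (simp only: lin_ext_lin_ext case_prod_unfold lin_ext_mon)
  also have "\<dots> = lin_ext (\<lambda>(p, q). lin_ext (\<lambda>ms. mon (p # ms)) (iter_comult e D (Suc (Suc a)) (mon q))) (D z)"
    by (simp only: step)
  finally show ?case .
qed

lemma iter_mult_comult_1: "iter_mult (iter_comult e D (Suc 0) z) = z"
  by (simp add: iter_mult_def lin_ext_lin_ext)

text \<open>Kept general in \<open>D\<close>: the same recursion, convolution with the identity,
  serves the Hopf powers via \<open>\<Delta>\<close> and the terms of the logarithm via the reduced
  coproduct.\<close>

lemma iter_mult_comult_Suc_Suc: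
  assumes "Vector_Spaces.linear scale scale D"
  shows "iter_mult (iter_comult e D (Suc (Suc a)) z) =
    lin_ext (\<lambda>(p, q). mon p * iter_mult (iter_comult e D (Suc a) (mon q))) (D z)"
  by (simp only: iter_comult_Suc_Suc[OF assms] iter_mult_def lin_ext_lin_ext case_prod_unfold
      lin_ext_mon list.map prod_list.Cons lin_ext_mult_right)

lemma tensor_mon_left: "tensor (mon m) y = lin_ext (\<lambda>n. mon (m, n)) y"
  by (simp add: tensor_def)

lemma tensor_mon_right: "tensor x (mon n) = lin_ext (\<lambda>m. mon (m, n)) x"
  by (simp add: tensor_def)

lemma lin_ext_mult_lin_ext:
  "lin_ext A s * lin_ext B t = lin_ext (\<lambda>m. lin_ext (\<lambda>n. A m * B n) t) s"
  for A :: "'m \<Rightarrow> ('x::comm_monoid_add \<Rightarrow>\<^sub>0 'k::field)"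
  by (subst lin_ext_mult_left, subst lin_ext_mult_right) simp

section \<open>Convolution powers of the projection onto the generators\<close>

text \<open>The projection \<xi> on basis monomials. Generators need not be primitive elements of
  the coalgebra.\<close>

definition prim :: "'g multiset \<Rightarrow> ('g, 'k::field) pol" where
  "prim p = (if size p = 1 then mon p else 0)"

definition unit_part :: "'g multiset \<Rightarrow> ('g, 'k::field) pol" where
  "unit_part p = (if p = {#} then 1 else 0)"

text \<open>A generator is no product of two nontrivial monomials, so one of the factors must be 1.
  This is the source of the Leibniz rule.\<close>

lemma prim_add: "prim (p + q) = unit_part p * prim q + prim p * unit_part q"
  by (cases "p = {#}"; cases "q = {#}")
    (auto simp: prim_def unit_part_def nonempty_has_size)

context graded_connected_polynomial_hopf
begin

text \<open>Positive degrees of the generators leave 1 as the only monomial of degree 0, and the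
  graded counit kills the others.\<close>

lemma counit_mon: "\<epsilon> (mon m) = (if m = {#} then 1 else 0)"
proof (cases "m = {#}")
  case True
  then show ?thesis using counit_one by (simp add: mon_zero)
next
  case False
  then obtain c m' where "m = add_mset c m'" by (cases m) auto
  then have "wt deg m > 0" using deg_pos by (simp add: wt_def)
  moreover have "mon m \<in> homog deg (wt deg m)" by (simp add: homog_def)
  ultimately show ?thesis using counit_graded False by auto
qed

lemma counit_eq_lookup: "\<epsilon> x = Poly_Mapping.lookup x {#}"
proof -
  interpret Vector_Spaces.linear scale "(*)" \<epsilon> by (rule linear_counit)
  have "\<epsilon> x = (\<Sum>m\<in>Poly_Mapping.keys x. Poly_Mapping.lookup x m * \<epsilon> (mon m))"
    by (subst expand_mon) (simp only: sum scale)
  also have "\<dots> = (\<Sum>m\<in>Poly_Mapping.keys x. if m = {#} then Poly_Mapping.lookup x m else 0)"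
    by (intro sum.cong) (auto simp: counit_mon)
  also have "\<dots> = Poly_Mapping.lookup x {#}" by (simp add: in_keys_iff)
  finally show ?thesis .
qed

text \<open>The counit axiom under an arbitrary linear map: only the terms
  \<open>1 \<otimes> q\<close> of the coproduct survive.\<close>

lemma lin_ext_counit_left:
  "lin_ext (\<lambda>(p, q). if p = {#} then \<phi> q else 0) (\<Delta> x) = lin_ext \<phi> x"
proof -
  have "lin_ext \<phi> x = lin_ext \<phi> (lin_ext (\<lambda>(p, q). scale (\<epsilon> (mon p)) (mon q)) (\<Delta> x))"
    by (simp only: counit_left)
  also have "\<dots> = lin_ext (\<lambda>(p, q). if p = {#} then \<phi> q else 0) (\<Delta> x)"
    unfolding lin_ext_lin_ext by (rule lin_ext_cong) (auto simp: lin_ext_scale counit_mon)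
  finally show ?thesis ..
qed

lemma lin_ext_counit_right:
  "lin_ext (\<lambda>(p, q). if q = {#} then \<phi> p else 0) (\<Delta> x) = lin_ext \<phi> x"
proof -
  have "lin_ext \<phi> x = lin_ext \<phi> (lin_ext (\<lambda>(p, q). scale (\<epsilon> (mon q)) (mon p)) (\<Delta> x))"
    by (simp only: counit_right)
  also have "\<dots> = lin_ext (\<lambda>(p, q). if q = {#} then \<phi> p else 0) (\<Delta> x)"
    unfolding lin_ext_lin_ext by (rule lin_ext_cong) (auto simp: lin_ext_scale counit_mon)
  finally show ?thesis ..
qed

text \<open>Coassociativity in Sweedler form, tested against an arbitrary trilinear expression
  \<open>\<psi>\<close>.\<close>

lemma lin_ext_coassoc:
  "lin_ext (\<lambda>(p, q). lin_ext (\<lambda>(r, s). \<psi> r s q) (\<Delta> (mon p))) (\<Delta> x) =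
   lin_ext (\<lambda>(p, q). lin_ext (\<lambda>(r, s). \<psi> p r s) (\<Delta> (mon q))) (\<Delta> x)"
proof -
  have "lin_ext (\<lambda>(p, r, s). \<psi> p r s) (tensor_assoc (tensor_map \<Delta> id (\<Delta> x)))
      = lin_ext (\<lambda>(p, r, s). \<psi> p r s) (tensor_map id \<Delta> (\<Delta> x))"
    by (simp only: coassoc)
  then show ?thesis
    by (simp add: tensor_assoc_def tensor_map_def lin_ext_lin_ext case_prod_unfold
        tensor_mon_left tensor_mon_right)
qed

text \<open>Values lie in the commutative polynomial algebra rather than the tensor algebra:
  multiplying the generators forgets their order, which amounts to the symmetrisation in
  \<open>f\<^sub>b\<close>.\<close>

primrec xi :: "nat \<Rightarrow> ('g, 'k) pol \<Rightarrow> ('g, 'k) pol" where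
  "xi 0 = (\<lambda>z. scale (\<epsilon> z) 1)"
| "xi (Suc n) = (\<lambda>z. lin_ext (\<lambda>(p, q). prim p * xi n (mon q)) (\<Delta> z))"

lemma xi_0_mon: "xi 0 (mon p) = unit_part p"
  by (simp add: counit_mon unit_part_def)

lemma linear_xi: "Vector_Spaces.linear scale scale (xi n)"
proof (cases n)
  case 0
  then show ?thesis
    by unfold_locales (simp_all add: counit_eq_lookup lookup_add pm.scale_left_distrib)
next
  case (Suc m)
  then have "xi n = lin_ext (\<lambda>(p, q). prim p * xi m (mon q)) \<circ> \<Delta>"
    by (simp add: o_def)
  then show ?thesis using Vector_Spaces.linear_compose[OF linear_comult linear_lin_ext] by (simp only:)
qed

lemma xi_add: "xi n (x + y) = xi n x + xi n y"
  and xi_scale: "xi n (scale a x) = scale a (xi n x)"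
  and xi_zero: "xi n 0 = 0"
  and xi_sum: "xi n (\<Sum>i\<in>I. h i) = (\<Sum>i\<in>I. xi n (h i))"
proof -
  interpret Vector_Spaces.linear scale scale "xi n" by (rule linear_xi)
  show "xi n (x + y) = xi n x + xi n y" "xi n (scale a x) = scale a (xi n x)" "xi n 0 = 0"
    "xi n (\<Sum>i\<in>I. h i) = (\<Sum>i\<in>I. xi n (h i))"
    by (rule add scale zero sum)+
qed

text \<open>Convolution is associative; here coassociativity enters.\<close>

lemma xi_conv:
  "lin_ext (\<lambda>(p, q). xi k (mon p) * xi l (mon q)) (\<Delta> z) = xi (k + l) z"
proof (induction k arbitrary: z)
  case 0
  have "lin_ext (\<lambda>(p, q). xi 0 (mon p) * xi l (mon q)) (\<Delta> z)
      = lin_ext (\<lambda>(p, q). if p = {#} then xi l (mon q) else 0) (\<Delta> z)"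
    by (rule lin_ext_cong) (auto simp: xi_0_mon unit_part_def simp del: xi.simps)
  also have "\<dots> = xi l z"
    by (simp only: lin_ext_counit_left flip: linear_eq_lin_ext[OF linear_xi])
  finally show ?case by simp
next
  case (Suc k)
  have "lin_ext (\<lambda>(p, q). xi (Suc k) (mon p) * xi l (mon q)) (\<Delta> z)
      = lin_ext (\<lambda>(p, q). lin_ext (\<lambda>(r, s). prim r * xi k (mon s) * xi l (mon q)) (\<Delta> (mon p))) (\<Delta> z)"
    by (simp add: lin_ext_mult_left case_prod_unfold)
  also have "\<dots> = lin_ext (\<lambda>(p, q). lin_ext (\<lambda>(r, s). prim p * xi k (mon r) * xi l (mon s)) (\<Delta> (mon q))) (\<Delta> z)"
    by (rule lin_ext_coassoc)
  also have "\<dots> = lin_ext (\<lambda>(p, q). prim p * lin_ext (\<lambda>(r, s). xi k (mon r) * xi l (mon s)) (\<Delta> (mon q))) (\<Delta> z)"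
    by (simp add: lin_ext_mult_right case_prod_unfold mult.assoc)
  finally show ?case by (simp add: Suc.IH)
qed

lemma xi_conv_unit_left:
  "lin_ext (\<lambda>(p, q). unit_part p * xi n (mon q)) (\<Delta> z) = xi n z"
  using xi_conv[of 0 n z] by (simp only: xi_0_mon add_0)

text \<open>As \<open>\<Delta>\<close> is multiplicative, \<open>prim_add\<close> splits the first
  factor \<xi> into the case where its generator comes from y and the case where it comes from x.
  Commutativity sorts the factors, and Pascal's rule combines the two sums.\<close>

lemma xi_mult:
  "xi n (x * y) = (\<Sum>k\<le>n. scale (of_nat (n choose k)) (xi k x * xi (n - k) y))"
proof (induction n arbitrary: x y)
  case 0
  then show ?case by (simp add: counit_mult scale_mult_left)
next
  case (Suc n)
  let ?c = "\<lambda>k. of_nat (n choose k)"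
  define A where "A k = (\<lambda>(p, q). unit_part p * xi k (mon q))" for k
  define P where "P k = (\<lambda>(p, q). prim p * xi k (mon q))" for k
  define T where "T k = xi k x * xi (Suc n - k) y" for k
  have A: "lin_ext (A k) (\<Delta> z) = xi k z" for k z
    unfolding A_def by (rule xi_conv_unit_left)
  have P: "lin_ext (P k) (\<Delta> z) = xi (Suc k) z" for k z
    by (simp add: P_def)
  have "xi (Suc n) (x * y) = lin_ext (\<lambda>u. lin_ext (\<lambda>v.
      prim (fst u + fst v) * xi n (mon (snd u) * mon (snd v))) (\<Delta> y)) (\<Delta> x)"
    by (simp add: comult_mult lin_ext_of_mult case_prod_unfold mon_mult)
  also have "\<dots> = lin_ext (\<lambda>u. lin_ext (\<lambda>v.
      (\<Sum>k\<le>n. scale (?c k) (A k u * P (n - k) v))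
      + (\<Sum>k\<le>n. scale (?c k) (P k u * A (n - k) v))) (\<Delta> y)) (\<Delta> x)"
    by (intro lin_ext_cong)
      (simp add: A_def P_def Suc.IH prim_add distrib_right distrib_left sum_distrib_left
        scale_mult_right pm.scale_right_distrib sum.distrib case_prod_unfold mult_ac del: xi.simps)
  also have "\<dots> = (\<Sum>k\<le>n. scale (?c k) (xi k x * xi (Suc (n - k)) y))
      + (\<Sum>k\<le>n. scale (?c k) (xi (Suc k) x * xi (n - k) y))"
    by (simp only: lin_ext_add_fun lin_ext_sum_fun lin_ext_scale_fun A P flip: lin_ext_mult_lin_ext)
  also have "\<dots> = (\<Sum>k\<le>n. scale (?c k) (T k)) + (\<Sum>k\<le>n. scale (?c k) (T (Suc k)))"
    by (simp add: T_def Suc_diff_le del: xi.simps)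
  \<comment> \<open>The added term has binomial coefficient 0; the sums can now be aligned for
    Pascal's rule.\<close>
  also have "(\<Sum>k\<le>n. scale (?c k) (T k)) = (\<Sum>k\<le>Suc n. scale (?c k) (T k))"
    by (simp add: binomial_eq_0)
  also have "\<dots> = T 0 + (\<Sum>k\<le>n. scale (?c (Suc k)) (T (Suc k)))"
    by (subst sum.atMost_Suc_shift) simp
  also have "T 0 + (\<Sum>k\<le>n. scale (?c (Suc k)) (T (Suc k))) + (\<Sum>k\<le>n. scale (?c k) (T (Suc k)))
      = (\<Sum>k\<le>Suc n. scale (of_nat (Suc n choose k)) (T k))"
    by (subst sum.atMost_Suc_shift) (simp add: pm.scale_left_distrib sum.distrib add_ac)
  finally show ?case by (simp only: T_def)
qed

end

section \<open>Forward differences of powers\<close>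

lemma choose_Suc_mult_Suc:
  "of_nat (Suc n choose Suc k) * of_nat (Suc k) = (of_nat (Suc n) * of_nat (n choose k) :: 'a::comm_ring_1)"
  by (simp only: Suc_times_binomial_eq flip: of_nat_mult)

text \<open>The \<open>n\<close>-th forward difference of \<open>x \<mapsto> x ^ l\<close> at \<open>0\<close>, i.e. the number of surjections from an
  \<open>l\<close>-set to an \<open>n\<close>-set.\<close>

definition fwd_diff :: "nat \<Rightarrow> nat \<Rightarrow> 'a::comm_ring_1" where
  "fwd_diff l n = (\<Sum>k\<le>n. (- 1) ^ (n - k) * of_nat (n choose k) * of_nat k ^ l)"

lemma fwd_diff_0_left: "fwd_diff 0 n = (if n = 0 then 1 else 0)"
proof -
  have "fwd_diff 0 n = (1 + (- 1 :: 'a)) ^ n"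
    by (subst binomial_ring) (simp add: fwd_diff_def mult.commute)
  then show ?thesis by (simp add: power_0_left)
qed

lemma fwd_diff_0_right: "fwd_diff l 0 = 0 ^ l"
  by (simp add: fwd_diff_def)

text \<open>The shift operator is 1 plus the forward difference: the right side is the n-th
  difference of \<open>x ^ l\<close> at 1.\<close>

lemma fwd_diff_Suc_add:
  "fwd_diff l (Suc n) + fwd_diff l n
    = (\<Sum>k\<le>n. (- 1) ^ (n - k) * of_nat (n choose k) * of_nat (Suc k) ^ l :: 'a::comm_ring_1)"
proof -
  define h :: "nat \<Rightarrow> 'a" where "h k = of_nat k ^ l" for k
  have "fwd_diff l (Suc n) = (- 1) ^ Suc n * h 0
      + (\<Sum>k\<le>n. (- 1) ^ (n - k) * of_nat (Suc n choose Suc k) * h (Suc k))"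
    unfolding fwd_diff_def by (subst sum.atMost_Suc_shift) (simp add: h_def)
  also have "(\<Sum>k\<le>n. (- 1) ^ (n - k) * of_nat (Suc n choose Suc k) * h (Suc k))
      = (\<Sum>k\<le>n. (- 1) ^ (n - k) * of_nat (n choose k) * h (Suc k))
        + (\<Sum>k\<le>n. (- 1) ^ (n - k) * of_nat (n choose Suc k) * h (Suc k))"
    by (simp add: sum.distrib[symmetric] algebra_simps)
  finally have 1: "fwd_diff l (Suc n) = (- 1) ^ Suc n * h 0
      + (\<Sum>k\<le>n. (- 1) ^ (n - k) * of_nat (n choose k) * h (Suc k))
      + (\<Sum>k\<le>n. (- 1) ^ (n - k) * of_nat (n choose Suc k) * h (Suc k))" by simp
  have "fwd_diff l n = (\<Sum>k\<le>Suc n. (- 1) ^ (n - k) * of_nat (n choose k) * h k)"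
    by (simp add: fwd_diff_def h_def binomial_eq_0)
  also have "\<dots> = (- 1) ^ n * h 0 + (\<Sum>k\<le>n. (- 1) ^ (n - Suc k) * of_nat (n choose Suc k) * h (Suc k))"
    by (subst sum.atMost_Suc_shift) simp
  also have "(\<Sum>k\<le>n. (- 1) ^ (n - Suc k) * of_nat (n choose Suc k) * h (Suc k))
      = - (\<Sum>k\<le>n. (- 1) ^ (n - k) * of_nat (n choose Suc k) * h (Suc k))"
    unfolding sum_negf[symmetric]
  proof (rule sum.cong)
    fix k assume "k \<in> {..n}"
    show "(- 1) ^ (n - Suc k) * of_nat (n choose Suc k) * h (Suc k)
        = - ((- 1) ^ (n - k) * of_nat (n choose Suc k) * h (Suc k))"
    \<comment> \<open>For \<open>k = n\<close> truncated subtraction gives the two powers equal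
      signs, but the binomial coefficient is 0.\<close>
    proof (cases "k < n")
      case True
      then have "n - k = Suc (n - Suc k)" by simp
      then show ?thesis by (simp only: power_Suc) simp
    qed (simp add: binomial_eq_0)
  qed simp
  finally show ?thesis using 1 by (simp add: h_def)
qed

text \<open>One factor k of the power is absorbed into the binomial coefficient. This is the
  surjection recurrence by the image of one point.\<close>

lemma fwd_diff_Suc_Suc:
  "fwd_diff (Suc l) (Suc n) = of_nat (Suc n) * (fwd_diff l (Suc n) + fwd_diff l n)"
proof -
  have "fwd_diff (Suc l) (Suc n)
      = (\<Sum>k\<le>n. (- 1) ^ (n - k) * (of_nat (Suc n choose Suc k) * of_nat (Suc k)) * of_nat (Suc k) ^ l :: 'a)"
    unfolding fwd_diff_def by (subst sum.atMost_Suc_shift) (simp add: mult_ac del: binomial_Suc_Suc of_nat_Suc)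
  also have "\<dots> = of_nat (Suc n) * (\<Sum>k\<le>n. (- 1) ^ (n - k) * of_nat (n choose k) * of_nat (Suc k) ^ l)"
    unfolding choose_Suc_mult_Suc sum_distrib_left
    by (intro sum.cong) (simp_all add: mult_ac del: of_nat_Suc)
  finally show ?thesis by (simp only: fwd_diff_Suc_add)
qed

lemma fwd_diff_eq_0: "l < n \<Longrightarrow> fwd_diff l n = 0"
proof (induction l arbitrary: n)
  case 0
  then show ?case by (simp add: fwd_diff_0_left)
next
  case (Suc l)
  then obtain m where "n = Suc m" "l < m" by (cases n) auto
  with Suc.IH show ?case by (simp add: fwd_diff_Suc_Suc)
qed

text \<open>Sorts surjections by the size k of the fibre over one point. In the computation
  \<open>(1 + i) ^ l\<close> is expanded, and the term \<open>k = 0\<close> cancels the second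
  summand of \<open>fwd_diff_Suc_add\<close>.\<close>

lemma fwd_diff_Suc_right:
  "fwd_diff l (Suc n) = (\<Sum>k=1..l. of_nat (l choose k) * fwd_diff (l - k) n :: 'a::comm_ring_1)"
proof -
  have "fwd_diff l (Suc n) + fwd_diff l n
      = (\<Sum>i\<le>n. \<Sum>k\<le>l. (- 1) ^ (n - i) * of_nat (n choose i) * (of_nat (l choose k) * of_nat i ^ (l - k)) :: 'a)"
    unfolding fwd_diff_Suc_add
    by (intro sum.cong) (simp_all add: binomial_ring sum_distrib_left)
  also have "\<dots> = (\<Sum>k\<le>l. of_nat (l choose k) * fwd_diff (l - k) n)"
    unfolding fwd_diff_def sum_distrib_left
    by (subst sum.swap) (simp add: mult_ac)
  also have "\<dots> = (\<Sum>k=1..l. of_nat (l choose k) * fwd_diff (l - k) n) + fwd_diff l n"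
    by (simp add: atMost_atLeast0 sum.atLeast_Suc_atMost)
  finally show ?thesis by simp
qed

text \<open>Newton's series \<open>D = \<Sum> (-1)^n / (n + 1) * \<Delta>^(n + 1)\<close> for the derivative of \<open>x ^ l\<close> at \<open>0\<close>.\<close>

lemma sum_log_fwd_diff:
  assumes "l \<le> N" "l > 0"
  shows "(\<Sum>n<N. (- 1) ^ n / of_nat (Suc n) * fwd_diff l (Suc n)) = (if l = 1 then 1 else 0 :: 'a::field_char_0)"
proof -
  obtain m where l: "l = Suc m" using assms(2) by (cases l) auto
  \<comment> \<open>The factor \<open>Suc n\<close> from \<open>fwd_diff_Suc_Suc\<close> cancels the
    denominator and leaves a telescoping sum.\<close>
  have "(\<Sum>n<N. (- 1) ^ n / of_nat (Suc n) * fwd_diff l (Suc n))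
      = (\<Sum>n<N. (- 1) ^ n * (fwd_diff m (Suc n) + fwd_diff m n) :: 'a)"
    by (simp add: l fwd_diff_Suc_Suc del: of_nat_Suc)
  also have "\<dots> = fwd_diff m 0 - (- 1) ^ N * fwd_diff m N"
    by (induction N) (simp_all add: algebra_simps)
  also have "fwd_diff m N = (0 :: 'a)" using assms l by (intro fwd_diff_eq_0) simp
  finally show ?thesis by (simp add: fwd_diff_0_right l)
qed

section \<open>Hopf powers and the Eulerian elements\<close>

context graded_connected_polynomial_hopf
begin

lemma xi_Suc_0: "xi (Suc 0) z = lin_ext prim z"
proof -
  have "xi (Suc 0) z = lin_ext (\<lambda>(p, q). if q = {#} then prim p else 0) (\<Delta> z)"
    unfolding xi.simps(2)
    by (rule lin_ext_cong) (auto simp: xi_0_mon unit_part_def simp del: xi.simps)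
  then show ?thesis by (simp only: lin_ext_counit_right)
qed

lemma xi_one: "xi n 1 = (if n = 0 then 1 else 0)"
proof (cases n)
  case 0
  then show ?thesis by (simp add: counit_one)
next
  case (Suc m)
  have e: "(1 :: ('g, 'k) pol2) = mon ({#}, {#})"
    by (simp add: mon_zero[symmetric] zero_prod_def)
  then show ?thesis using Suc by (simp add: comult_one e prim_def)
qed

lemma Psi_1: "Psi \<epsilon> \<Delta> (Suc 0) z = z"
  by (simp only: Psi_def iter_mult_comult_1)

lemma Psi_Suc_Suc:
  "Psi \<epsilon> \<Delta> (Suc (Suc a)) z = lin_ext (\<lambda>(p, q). mon p * Psi \<epsilon> \<Delta> (Suc a) (mon q)) (\<Delta> z)"
  unfolding Psi_def by (rule iter_mult_comult_Suc_Suc) (rule linear_comult)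

lemma xi_lin_ext: "xi n (lin_ext \<phi> x) = lin_ext (\<lambda>m. xi n (\<phi> m)) x"
  by (rule linear_comp_lin_ext) (rule linear_xi)

text \<open>One more convolution factor id contributes, by the Leibniz rule and
  \<open>xi_conv\<close>, the binomial expansion of (1 + a)^n.\<close>

lemma xi_Psi: "xi n (Psi \<epsilon> \<Delta> (Suc a) z) = scale (of_nat (Suc a) ^ n) (xi n z)"
proof (induction a arbitrary: n z)
  case 0
  then show ?case by (simp add: Psi_1 del: xi.simps)
next
  case (Suc a)
  let ?c = "\<lambda>k. of_nat (n choose k) * of_nat (Suc a) ^ (n - k) :: 'k"
  have "xi n (Psi \<epsilon> \<Delta> (Suc (Suc a)) z)
      = lin_ext (\<lambda>u. xi n (mon (fst u) * Psi \<epsilon> \<Delta> (Suc a) (mon (snd u)))) (\<Delta> z)"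
    by (simp only: Psi_Suc_Suc xi_lin_ext case_prod_unfold)
  also have "\<dots> = (\<Sum>k\<le>n. scale (?c k)
      (lin_ext (\<lambda>(p, q). xi k (mon p) * xi (n - k) (mon q)) (\<Delta> z)))"
    by (simp only: xi_mult Suc.IH scale_mult_right pm.scale_scale lin_ext_sum_fun lin_ext_scale_fun
        case_prod_unfold)
  also have "\<dots> = (\<Sum>k\<le>n. scale (?c k) (xi n z))"
    by (intro sum.cong) (simp_all only: xi_conv atMost_iff le_add_diff_inverse)
  also have "\<dots> = scale (\<Sum>k\<le>n. ?c k) (xi n z)"
    by (simp only: pm.scale_sum_left)
  also have "(\<Sum>k\<le>n. ?c k) = (1 + of_nat (Suc a)) ^ n"
    by (subst binomial_ring) simp
  finally show ?case by simp
qed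

section \<open>Preservation of degree and finiteness of the graded pieces\<close>

lemma keys_comult_mon:
  "(p, q) \<in> Poly_Mapping.keys (\<Delta> (mon m)) \<Longrightarrow> wt deg p + wt deg q = wt deg m"
  using comult_graded[of "mon m" "wt deg m"] by (auto simp: homog_def homog2_def)

lemma wt_eq_0_iff [simp]: "wt deg m = 0 \<longleftrightarrow> m = {#}"
  using deg_pos by (cases m) (auto simp: wt_def)

lemma wt_add: "wt deg (p + q) = wt deg p + wt deg q"
  by (simp add: wt_def)

lemma keys_mon_mult:
  "b \<in> Poly_Mapping.keys (mon p * x) \<Longrightarrow> \<exists>m\<in>Poly_Mapping.keys x. b = p + m"
  for x :: "('g, 'k) pol"
  by (auto simp: in_keys_iff lookup_mon_mult subset_mset.add_diff_inverse split: if_splits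
      intro!: bexI[of _ "b - p"])

lemma wt_keys_Psi:
  "b \<in> Poly_Mapping.keys (Psi \<epsilon> \<Delta> (Suc a) (mon m)) \<Longrightarrow> wt deg b = wt deg m"
proof (induction a arbitrary: b m)
  case 0
  then show ?case by (simp add: Psi_1)
next
  case (Suc a)
  from Suc.prems obtain p q where pq: "(p, q) \<in> Poly_Mapping.keys (\<Delta> (mon m))"
    and "b \<in> Poly_Mapping.keys (mon p * Psi \<epsilon> \<Delta> (Suc a) (mon q))"
    unfolding Psi_Suc_Suc by (auto elim!: keys_lin_ext)
  then obtain b' where "b' \<in> Poly_Mapping.keys (Psi \<epsilon> \<Delta> (Suc a) (mon q))" "b = p + b'"
    using keys_mon_mult by blast
  with Suc.IH[of b' q] keys_comult_mon[OF pq] show ?case by (simp add: wt_add)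
qed

lemma wt_keys_xi:
  "b \<in> Poly_Mapping.keys (xi n (mon m)) \<Longrightarrow> wt deg b = wt deg m"
proof (induction n arbitrary: b m)
  case 0
  then show ?case by (auto simp: xi_0_mon unit_part_def simp del: xi.simps split: if_splits)
next
  case (Suc n)
  from Suc.prems obtain p q where pq: "(p, q) \<in> Poly_Mapping.keys (\<Delta> (mon m))"
    and "b \<in> Poly_Mapping.keys (prim p * xi n (mon q))"
    by (auto elim!: keys_lin_ext)
  then obtain b' where "b' \<in> Poly_Mapping.keys (xi n (mon q))" "b = p + b'"
    using keys_mon_mult by (auto simp: prim_def split: if_splits)
  with Suc.IH[of b' q] keys_comult_mon[OF pq] show ?case by (simp add: wt_add)
qed

text \<open>A finite spanning set involves only finitely many monomials, and every monomial of
  degree n lies in its span, hence is one of them.\<close>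

lemma finite_wt: "finite {m. wt deg m = n}"
proof -
  obtain B where B: "finite B" "(homog deg n :: ('g, 'k) pol set) \<subseteq> pm.span B"
    using finite_dim by blast
  have "Poly_Mapping.keys x \<subseteq> (\<Union>y\<in>B. Poly_Mapping.keys y)" if "x \<in> pm.span B" for x
    using that
  proof (induction rule: pm.span_induct_alt)
    case base
    then show ?case by simp
  next
    case (step a x y)
    have "Poly_Mapping.keys (scale a x) \<subseteq> Poly_Mapping.keys x" by (auto simp: in_keys_iff)
    with step Poly_Mapping.keys_add[of "scale a x" y] show ?case by blast
  qed
  moreover have "mon m \<in> pm.span B" if "wt deg m = n" for m
    using B(2) that by (auto simp: homog_def)
  ultimately have "{m. wt deg m = n} \<subseteq> (\<Union>y\<in>B. Poly_Mapping.keys y)"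
    by (metis (mono_tags, lifting) UN_I keys_mon insertI1 mem_Collect_eq subset_iff)
  then show ?thesis by (rule finite_subset) (simp add: B(1))
qed

section \<open>The reduced coproduct and the terms of the logarithm\<close>

lemma linear_reduced_comult: "Vector_Spaces.linear scale scale (reduced_comult \<Delta>)"
proof -
  interpret Vector_Spaces.linear scale scale \<Delta> by (rule linear_comult)
  have "tensor (1 :: ('g, 'k) pol) x = lin_ext (\<lambda>n. mon ({#}, n)) x"
    "tensor x (1 :: ('g, 'k) pol) = lin_ext (\<lambda>n. mon (n, {#})) x" for x :: "('g, 'k) pol"
    by (simp_all add: tensor_mon_left tensor_mon_right flip: mon_zero)
  then show ?thesis
    by unfold_locales
      (simp_all add: reduced_comult_def add scale lin_ext_add lin_ext_scale pm.scale_right_diff_distrib)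
qed

text \<open>On the kernel of \<epsilon>, subtracting \<open>1 \<otimes> z\<close> and
  \<open>z \<otimes> 1\<close> deletes exactly the terms of the coproduct with a trivial tensor
  factor.\<close>

lemma lin_ext_reduced_comult:
  assumes "\<epsilon> z = 0"
  shows "lin_ext (\<lambda>(p, q). \<phi> p q) (reduced_comult \<Delta> z) =
    lin_ext (\<lambda>(p, q). if p = {#} \<or> q = {#} then 0 else \<phi> p q) (\<Delta> z)"
proof -
  interpret L: Vector_Spaces.linear scale scale "lin_ext (\<lambda>(p, q). \<phi> p q)" by simp
  let ?l = "\<lambda>\<psi>. lin_ext (\<lambda>(p, q). \<psi> p q) (\<Delta> z)"
  have t: "tensor (1 :: ('g, 'k) pol) z = lin_ext (\<lambda>n. mon ({#}, n)) z"
    "tensor z (1 :: ('g, 'k) pol) = lin_ext (\<lambda>n. mon (n, {#})) z"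
    by (simp_all add: tensor_mon_left tensor_mon_right flip: mon_zero)
  \<comment> \<open>The overlap of the two deleted families is the \<open>1 \<otimes> 1\<close>
    term, whose coefficient is \<open>\<epsilon> z = 0\<close>.\<close>
  have "lin_ext (\<lambda>q. if q = {#} then \<phi> {#} {#} else 0) z = 0"
    using assms unfolding lin_ext_def
    by (intro sum.neutral) (auto simp: counit_eq_lookup in_keys_iff)
  then have 0: "?l (\<lambda>p q. if p = {#} then if q = {#} then \<phi> {#} {#} else 0 else 0) = 0"
    by (simp only: lin_ext_counit_left)
  have "lin_ext (\<lambda>(p, q). \<phi> p q) (reduced_comult \<Delta> z)
      = ?l \<phi> - lin_ext (\<phi> {#}) z - lin_ext (\<lambda>p. \<phi> p {#}) z"
    by (simp add: reduced_comult_def L.diff t lin_ext_lin_ext)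
  also have "lin_ext (\<phi> {#}) z = ?l (\<lambda>p q. if p = {#} then \<phi> {#} q else 0)"
    by (simp only: lin_ext_counit_left)
  also have "lin_ext (\<lambda>p. \<phi> p {#}) z = ?l (\<lambda>p q. if q = {#} then \<phi> p {#} else 0)"
    by (simp only: lin_ext_counit_right)
  \<comment> \<open>Inclusion-exclusion over \<open>p = {#}\<close> and
    \<open>q = {#}\<close>.\<close>
  also have "?l \<phi> = ?l (\<lambda>p q. if p = {#} \<or> q = {#} then 0 else \<phi> p q)
      + ?l (\<lambda>p q. if p = {#} then \<phi> {#} q else 0) + ?l (\<lambda>p q. if q = {#} then \<phi> p {#} else 0)
      - ?l (\<lambda>p q. if p = {#} then if q = {#} then \<phi> {#} {#} else 0 else 0)"
    unfolding eq_diff_eq lin_ext_add_fun[symmetric] by (rule lin_ext_cong) auto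
  finally show ?thesis by (simp add: 0)
qed

text \<open>Indexed as in \<open>euler\<close>, with n + 1 tensor factors. On the kernel of
  \<epsilon> it is the (n + 1)-st convolution power of id minus the unit-counit map, which makes
  \<open>euler\<close> the logarithm of id there.\<close>

definition red :: "nat \<Rightarrow> ('g, 'k) pol \<Rightarrow> ('g, 'k) pol" where
  "red n z = iter_mult (iter_comult \<epsilon> (reduced_comult \<Delta>) (Suc n) z)"

lemma red_0: "red 0 z = z"
  by (simp only: red_def iter_mult_comult_1)

lemma red_Suc:
  assumes "\<epsilon> z = 0"
  shows "red (Suc n) z =
    lin_ext (\<lambda>(p, q). if p = {#} \<or> q = {#} then 0 else mon p * red n (mon q)) (\<Delta> z)"
  unfolding red_def iter_mult_comult_Suc_Suc[OF linear_reduced_comult]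
  by (rule lin_ext_reduced_comult) (rule assms)

text \<open>The argument of \<open>xi_Psi\<close> with id replaced by id minus the unit-counit map:
  the binomial sum loses its term \<open>k = 0\<close>, which gives the recursion
  \<open>fwd_diff_Suc_right\<close>.\<close>

lemma xi_red:
  assumes "\<epsilon> z = 0"
  shows "xi l (red n z) = scale (fwd_diff l (Suc n)) (xi l z)"
  using assms
proof (induction n arbitrary: l z)
  case 0
  have "fwd_diff l (Suc 0) = (1 :: 'k) - 0 ^ l" by (simp add: fwd_diff_def)
  then show ?case using 0 by (cases l) (simp_all add: red_0 del: xi.simps(2))
next
  case (Suc n)
  let ?c = "\<lambda>k. of_nat (l choose k) * fwd_diff (l - k) (Suc n) :: 'k"
  have "xi l (red (Suc n) z)
      = lin_ext (\<lambda>(p, q). xi l (if p = {#} \<or> q = {#} then 0 else mon p * red n (mon q))) (\<Delta> z)"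
    by (simp only: red_Suc[OF Suc.prems] xi_lin_ext case_prod_unfold)
  also have "\<dots> = lin_ext (\<lambda>(p, q). \<Sum>k=1..l. scale (?c k) (xi k (mon p) * xi (l - k) (mon q))) (\<Delta> z)"
  proof (rule lin_ext_cong, clarify)
    fix p q
    show "xi l (if p = {#} \<or> q = {#} then 0 else mon p * red n (mon q))
      = (\<Sum>k=1..l. scale (?c k) (xi k (mon p) * xi (l - k) (mon q)))"
    proof (cases "p = {#} \<or> q = {#}")
      case True
      \<comment> \<open>If p is trivial, \<open>xi k\<close> kills it since \<open>k > 0\<close>. If
        q is trivial, only \<open>k = l\<close> could survive, where
        \<open>fwd_diff 0 (Suc n)\<close> is 0.\<close>
      have "scale (?c k) (xi k (mon p) * xi (l - k) (mon q)) = 0" if "k \<in> {1..l}" for k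
        using True that
        by (cases "k = l") (auto simp: xi_one mon_zero fwd_diff_0_left simp del: xi.simps)
      then have "(\<Sum>k=1..l. scale (?c k) (xi k (mon p) * xi (l - k) (mon q))) = 0"
        by (intro sum.neutral) blast
      then show ?thesis using True by (simp only: if_True xi_zero)
    next
      case False
      then have "xi l (if p = {#} \<or> q = {#} then 0 else mon p * red n (mon q))
          = (\<Sum>k\<le>l. scale (?c k) (xi k (mon p) * xi (l - k) (mon q)))"
        by (simp add: xi_mult Suc.IH counit_mon scale_mult_right del: xi.simps)
      also have "\<dots> = (\<Sum>k=1..l. scale (?c k) (xi k (mon p) * xi (l - k) (mon q)))"
        using False
        by (simp add: atMost_atLeast0 sum.atLeast_Suc_atMost xi_0_mon unit_part_def del: xi.simps)
      finally show ?thesis .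
    qed
  qed
  also have "\<dots> = (\<Sum>k=1..l. scale (?c k) (lin_ext (\<lambda>(p, q). xi k (mon p) * xi (l - k) (mon q)) (\<Delta> z)))"
    by (simp only: lin_ext_sum_fun lin_ext_scale_fun case_prod_unfold)
  also have "\<dots> = (\<Sum>k=1..l. scale (?c k) (xi l z))"
    by (intro sum.cong) (simp_all only: xi_conv atLeastAtMost_iff le_add_diff_inverse)
  also have "\<dots> = scale (fwd_diff l (Suc (Suc n))) (xi l z)"
    by (simp only: fwd_diff_Suc_right[of l "Suc n"] pm.scale_sum_left)
  finally show ?case .
qed

text \<open>Each reduced coproduct splits off a factor of positive degree, so the degree bounds the
  number of factors. This makes the logarithm a finite sum.\<close>

lemma red_mon_eq_0: "m \<noteq> {#} \<Longrightarrow> wt deg m \<le> n \<Longrightarrow> red n (mon m) = 0"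
proof (induction n arbitrary: m)
  case 0
  then show ?case by simp
next
  case (Suc n)
  have "red (Suc n) (mon m) = lin_ext (\<lambda>(p, q). 0) (\<Delta> (mon m))"
    unfolding red_Suc[of "mon m", unfolded counit_mon, OF if_not_P[OF Suc.prems(1)]]
  proof (rule lin_ext_cong, clarify)
    fix p q assume pq: "(p, q) \<in> Poly_Mapping.keys (\<Delta> (mon m))"
    show "(if p = {#} \<or> q = {#} then 0 else mon p * red n (mon q)) = 0"
    proof (cases "p = {#} \<or> q = {#}")
      case False
      then have "wt deg p > 0" by (simp flip: neq0_conv)
      then have "wt deg q \<le> n" using keys_comult_mon[OF pq] Suc.prems by simp
      then show ?thesis using Suc.IH False by simp
    qed simp
  qed
  then show ?case by (simp add: case_prod_unfold)
qed

end

section \<open>Values of the convolution powers on monomials and on the elements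
  \<open>g\<^sub>b\<close>\<close>

locale graded_connected_polynomial_hopf_char_0 =
  graded_connected_polynomial_hopf deg \<Delta> \<epsilon> antipode
  for deg :: "'g \<Rightarrow> nat"
    and \<Delta> :: "('g, 'k::field_char_0) pol \<Rightarrow> ('g, 'k) pol2"
    and \<epsilon> :: "('g, 'k) pol \<Rightarrow> 'k"
    and antipode :: "('g, 'k) pol \<Rightarrow> ('g, 'k) pol"
begin

text \<open>Peel off one generator by the Leibniz rule. Order 0 on it gives 0, order 1 gives the
  recursion, and from order 2 on the order left for the rest is below its length, so induction kills
  it.\<close>

lemma xi_mon:
  "n \<le> size b \<Longrightarrow> xi n (mon b) = (if n = size b then scale (fact n) (mon b) else 0)"
proof (induction b arbitrary: n)
  case empty
  then show ?case by (simp add: xi_one mon_zero del: xi.simps)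
next
  case (add c b)
  show ?case
  proof (cases n)
    case 0
    then show ?thesis by (simp add: counit_mon)
  next
    case (Suc m)
    with add.prems have m: "m \<le> size b" by simp
    have "xi n (mon (add_mset c b)) = xi n (mon {#c#} * mon b)" by (simp add: mon_mult)
    also have "\<dots> = (\<Sum>k\<le>n. scale (of_nat (n choose k)) (xi k (mon {#c#}) * xi (n - k) (mon b)))"
      by (rule xi_mult)
    also have "\<dots> = (\<Sum>k\<le>n. if k = 1 then
        scale (of_nat n) (mon {#c#} * (if m = size b then scale (fact m) (mon b) else 0)) else 0)"
    proof (rule sum.cong)
      fix k assume k: "k \<in> {..n}"
      consider "k = 0" | "k = 1" | "k \<ge> 2" by linarith
      then show "scale (of_nat (n choose k)) (xi k (mon {#c#}) * xi (n - k) (mon b)) =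
        (if k = 1 then scale (of_nat n) (mon {#c#} * (if m = size b then scale (fact m) (mon b) else 0)) else 0)"
      proof cases
        case 1
        then show ?thesis by (simp add: xi_0_mon unit_part_def del: xi.simps)
      next
        case 2
        then show ?thesis using add.IH[OF m] Suc by (simp add: xi_Suc_0 prim_def del: xi.simps)
      next
        case 3
        then have "n - k < size b" using m Suc k by simp
        with add.IH[of "n - k"] 3 show ?thesis by simp
      qed
    qed simp
    also have "\<dots> = (if n = size (add_mset c b) then scale (fact n) (mon (add_mset c b)) else 0)"
      by (simp add: Suc mon_mult scale_mult_right mult.commute)
    finally show ?thesis .
  qed
qed

text \<open>The induction of \<open>xi_mon\<close> for factors that respond to order 1 only, so that
  every order n is determined. It is applied to the Eulerian elements of the generators.\<close>

lemma xi_prod_mset: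
  assumes u: "\<And>c n. xi n (u c) = (if n = 1 then mon {#c#} else 0)"
  shows "xi n (\<Prod>c\<in>#b. u c) = (if n = size b then scale (fact n) (mon b) else 0)"
proof (induction b arbitrary: n)
  case empty
  then show ?case by (simp add: xi_one mon_zero del: xi.simps)
next
  case (add c b)
  have "xi n (\<Prod>d\<in>#add_mset c b. u d)
      = (\<Sum>k\<le>n. scale (of_nat (n choose k)) (xi k (u c) * xi (n - k) (\<Prod>d\<in>#b. u d)))"
    by (simp add: xi_mult)
  also have "\<dots> = (\<Sum>k\<le>n. if k = 1 then
      scale (of_nat n) (mon {#c#} * (if n - 1 = size b then scale (fact (n - 1)) (mon b) else 0)) else 0)"
    unfolding u add.IH by (intro sum.cong) auto
  also have "\<dots> = (if n = size (add_mset c b) then scale (fact n) (mon (add_mset c b)) else 0)"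
    by (cases n) (auto simp: mon_mult scale_mult_right mult.commute)
  finally show ?case .
qed

lemma xi_euler: "xi l (euler \<epsilon> \<Delta> (mon {#c#})) = (if l = 1 then mon {#c#} else 0)"
proof -
  let ?z = "mon {#c#} :: ('g, 'k) pol" and ?a = "\<lambda>n. (- 1) ^ n / of_nat (Suc n) :: 'k"
  \<comment> \<open>The first summand bounds the nonzero terms of the logarithm, the second makes
    the range long enough for Newton's series.\<close>
  define N where "N = wt deg {#c#} + l"
  have z: "\<epsilon> ?z = 0" by (simp add: counit_mon)
  have e: "euler \<epsilon> \<Delta> ?z = (\<Sum>n<N. scale (?a n) (red n ?z))"
    unfolding euler_def red_def[symmetric]
    by (rule Sum_any.expand_superset) (auto simp: N_def red_mon_eq_0 not_le intro: ccontr)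
  have "xi l (euler \<epsilon> \<Delta> ?z) = scale (\<Sum>n<N. ?a n * fwd_diff l (Suc n)) (xi l ?z)"
    by (simp add: e xi_sum xi_scale xi_red[OF z] pm.scale_sum_left del: xi.simps of_nat_Suc)
  also have "\<dots> = (if l = 1 then mon {#c#} else 0)"
  proof (cases "l = 0")
    case True
    then show ?thesis using z by simp
  next
    case False
    then have "(\<Sum>n<N. ?a n * fwd_diff l (Suc n)) = (if l = 1 then 1 else 0)"
      by (intro sum_log_fwd_diff) (simp_all add: N_def)
    then show ?thesis by (simp add: xi_Suc_0 prim_def del: xi.simps)
  qed
  finally show ?thesis .
qed

lemma xi_g_elt: "xi n (g_elt \<epsilon> \<Delta> b) = (if n = size b then scale (fact n) (mon b) else 0)"
  unfolding g_elt_def by (rule xi_prod_mset) (rule xi_euler)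

end

section \<open>Symmetrised products of dual generators\<close>

text \<open>By orbit counting, every rearrangement of \<open>cs\<close> arises from equally many
  permutations of positions; their number is the product of the factorials of the
  multiplicities.\<close>

lemma sum_permute_list:
  fixes G :: "'a list \<Rightarrow> 'b::comm_semiring_1"
  shows "(\<Sum>\<sigma> | \<sigma> permutes {..<length cs}. G (permute_list \<sigma> cs)) =
    of_nat (\<Prod>c\<in>set_mset (mset cs). fact (count (mset cs) c)) *
      (\<Sum>w\<in>permutations_of_multiset (mset cs). G w)"
proof -
  define S where "S = {\<sigma>. \<sigma> permutes {..<length cs}}"
  define P where "P = permutations_of_multiset (mset cs)"
  define N where "N w = {\<sigma>\<in>S. permute_list \<sigma> cs = w}" for w
  have fin: "finite S" by (simp add: S_def finite_permutations)
  have "permute_list \<sigma> cs \<in> P" if "\<sigma> \<in> S" for \<sigma>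
    using that by (auto simp: S_def P_def intro: permutations_of_multisetI)
  moreover have ex: "\<exists>\<sigma>\<in>S. permute_list \<sigma> cs = w" if "w \<in> P" for w
  proof -
    have "mset w = mset cs" using that by (auto simp: P_def dest: permutations_of_multisetD)
    then show ?thesis unfolding S_def by (metis mset_eq_permutation mem_Collect_eq)
  qed
  ultimately have img: "(\<lambda>\<sigma>. permute_list \<sigma> cs) ` S = P" by blast
  \<comment> \<open>Composing with a permutation that carries \<open>cs\<close> to \<open>w\<close>
    maps the stabiliser of \<open>cs\<close> bijectively onto the fibre over
    \<open>w\<close>.\<close>
  have card_N: "card (N w) = card (N cs)" if w: "w \<in> P" for w
  proof -
    from ex[OF w] obtain p where p: "p permutes {..<length cs}" "permute_list p cs = w"
      by (auto simp: S_def)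
    have ip: "inv p permutes {..<length cs}" using p(1) by (rule permutes_inv)
    have "permute_list (inv p) w = cs"
      using permute_list_compose[OF ip, of p] p
      by (simp add: permutes_inv_o)
    then have "bij_betw (\<lambda>\<sigma>. \<sigma> \<circ> p) (N cs) (N w)"
      using p ip unfolding N_def S_def
      by (intro bij_betw_byWitness[where f' = "\<lambda>\<sigma>. \<sigma> \<circ> inv p"])
        (auto simp: permute_list_compose permutes_compose permutes_inv_o comp_assoc)
    then show ?thesis by (metis bij_betw_same_card)
  qed
  \<comment> \<open>Counting all permutations by fibres and comparing with the multinomial formula
    for \<open>card P\<close> gives the size of a fibre.\<close>
  have "fact (length cs) = card S"
    by (simp add: S_def card_permutations[of "{..<length cs}"])
  also have "\<dots> = (\<Sum>w\<in>P. card (N w))"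
    using sum.image_gen[OF fin, of "\<lambda>_. 1" "\<lambda>\<sigma>. permute_list \<sigma> cs"] by (simp only: card_eq_sum img N_def)
  also have "\<dots> = card P * card (N cs)" by (simp add: card_N)
  finally have "card P * card (N cs)
      = card P * (\<Prod>c\<in>set_mset (mset cs). fact (count (mset cs) c))"
    unfolding P_def using card_permutations_of_multiset_aux[of "mset cs"] by simp
  moreover have "card P \<noteq> 0"
    by (simp add: P_def finite_permutations_of_multiset permutations_of_multiset_not_empty)
  ultimately have N: "card (N cs) = (\<Prod>c\<in>set_mset (mset cs). fact (count (mset cs) c))" by simp
  have "(\<Sum>\<sigma>\<in>S. G (permute_list \<sigma> cs)) = (\<Sum>w\<in>P. \<Sum>\<sigma>\<in>N w. G (permute_list \<sigma> cs))"
    unfolding N_def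
    by (subst sum.image_gen[OF fin, of _ "\<lambda>\<sigma>. permute_list \<sigma> cs"]) (simp only: img)
  also have "\<dots> = (\<Sum>w\<in>P. of_nat (card (N cs)) * G w)"
  proof (rule sum.cong)
    fix w assume w: "w \<in> P"
    have "(\<Sum>\<sigma>\<in>N w. G (permute_list \<sigma> cs)) = (\<Sum>\<sigma>\<in>N w. G w)"
      by (rule sum.cong) (auto simp: N_def)
    then show "(\<Sum>\<sigma>\<in>N w. G (permute_list \<sigma> cs)) = of_nat (card (N cs)) * G w"
      by (simp add: card_N[OF w])
  qed simp
  finally show ?thesis by (simp only: S_def P_def N sum_distrib_left)
qed

lemma sum_fun_apply: "(\<Sum>i\<in>I. F i) x = (\<Sum>i\<in>I. F i x)"
  by (induction I rule: infinite_finite_induct) auto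

lemma dual_tensor_eq_sum:
  "dual_tensor f g t =
    (\<Sum>u\<in>Poly_Mapping.keys t. Poly_Mapping.lookup t u * (f (mon (fst u)) * g (mon (snd u))))"
  by (simp add: dual_tensor_def case_prod_unfold)

lemma dual_mon: "dual m (mon n) = (if m = n then 1 else 0)"
  by (auto simp: dual_def lookup_mon)

text \<open>At most one term of the sum is nonzero; this form matches the decomposition of words by
  their first letter.\<close>

lemma lookup_prim_mult:
  "Poly_Mapping.lookup (prim p * x) b =
    (\<Sum>c\<in>set_mset b. dual {#c#} (mon p :: ('g, 'k) pol) * Poly_Mapping.lookup x (b - {#c#}))"
  for x :: "('g, 'k::field) pol"
proof (cases "size p = 1")
  case True
  then obtain d where d: "p = {#d#}" by (metis size_1_singleton_mset)
  have "(\<Sum>c\<in>set_mset b. dual {#c#} (mon p :: ('g, 'k) pol) * Poly_Mapping.lookup x (b - {#c#}))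
      = (\<Sum>c\<in>set_mset b. if c = d then Poly_Mapping.lookup x (b - {#d#}) else 0)"
    by (intro sum.cong) (auto simp: dual_mon d)
  then show ?thesis by (simp add: prim_def d lookup_mon_mult)
next
  case False
  then have "dual {#c#} (mon p :: ('g, 'k) pol) = 0" for c
    by (auto simp: dual_mon)
  with False show ?thesis by (simp add: prim_def)
qed

section \<open>Linear functionals and the graded dual\<close>

lemma linear_functionalI:
  fixes \<phi> :: "('m \<Rightarrow>\<^sub>0 'k::field) \<Rightarrow> 'k"
  assumes "\<And>x y. \<phi> (x + y) = \<phi> x + \<phi> y" "\<And>a x. \<phi> (scale a x) = a * \<phi> x"
  shows "Vector_Spaces.linear scale (*) \<phi>"
proof -
  have "vector_space ((*) :: 'k \<Rightarrow> 'k \<Rightarrow> 'k)"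
    by (rule vector_space.intro) (simp_all only: distrib_left distrib_right mult.assoc mult_1_left)
  then show ?thesis
    unfolding Vector_Spaces.linear_iff using assms pm.vector_space_axioms by blast
qed

lemma linear_functional_eq_sum:
  fixes \<phi> :: "('m \<Rightarrow>\<^sub>0 'k::field) \<Rightarrow> 'k"
  assumes "Vector_Spaces.linear scale (*) \<phi>"
  shows "\<phi> x = (\<Sum>m\<in>Poly_Mapping.keys x. Poly_Mapping.lookup x m * \<phi> (mon m))"
proof -
  interpret Vector_Spaces.linear scale "(*)" \<phi> by fact
  show ?thesis by (subst expand_mon) (simp only: sum scale)
qed

lemma subspace_graded_dual: "fn.subspace (graded_dual deg :: (('g, 'k::field) pol \<Rightarrow> 'k) set)"
proof (rule fn.subspaceI)
  have "Vector_Spaces.linear scale (*) (0 :: ('g, 'k) pol \<Rightarrow> 'k)"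
    by (rule linear_functionalI) simp_all
  then show "0 \<in> (graded_dual deg :: (('g, 'k) pol \<Rightarrow> 'k) set)"
    by (simp add: graded_dual_def)
next
  fix x y :: "('g, 'k) pol \<Rightarrow> 'k"
  assume x: "x \<in> graded_dual deg" and y: "y \<in> graded_dual deg"
  have "{n. \<exists>z\<in>homog deg n. (x + y) z \<noteq> 0}
      \<subseteq> {n. \<exists>z\<in>homog deg n. x z \<noteq> 0} \<union> {n. \<exists>z\<in>homog deg n. y z \<noteq> 0}" by fastforce
  moreover have "finite ({n. \<exists>z\<in>homog deg n. x z \<noteq> 0} \<union> {n. \<exists>z\<in>homog deg n. y z \<noteq> 0})"
    using x y by (simp add: graded_dual_def)
  ultimately have "finite {n. \<exists>z\<in>homog deg n. (x + y) z \<noteq> 0}" by (rule finite_subset)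
  moreover have "Vector_Spaces.linear scale (*) (x + y)"
    using x y
    by (intro linear_functionalI) (simp_all add: graded_dual_def Vector_Spaces.linear_iff distrib_left)
  ultimately show "x + y \<in> graded_dual deg" by (simp add: graded_dual_def)
next
  fix c and x :: "('g, 'k) pol \<Rightarrow> 'k"
  assume x: "x \<in> graded_dual deg"
  have "{n. \<exists>z\<in>homog deg n. fscale c x z \<noteq> 0} \<subseteq> {n. \<exists>z\<in>homog deg n. x z \<noteq> 0}"
    by (auto simp: fscale_def)
  moreover have "finite {n. \<exists>z\<in>homog deg n. x z \<noteq> 0}" using x by (simp add: graded_dual_def)
  ultimately have "finite {n. \<exists>z\<in>homog deg n. fscale c x z \<noteq> 0}" by (rule finite_subset)
  moreover have "Vector_Spaces.linear scale (*) (fscale c x)"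
    using x by (intro linear_functionalI)
      (simp_all add: graded_dual_def Vector_Spaces.linear_iff fscale_def distrib_left)
  ultimately show "fscale c x \<in> graded_dual deg" by (simp add: graded_dual_def)
qed

context graded_connected_polynomial_hopf
begin

text \<open>\<open>foldr\<close> peels off the first functional, and
  \<open>iter_comult_Suc_Suc\<close> peels off the matching first tensor factor.\<close>

lemma dual_prod_dual:
  "dual_prod \<epsilon> \<Delta> (map dual ms) z = Poly_Mapping.lookup (iter_comult \<epsilon> \<Delta> (length ms) z) ms"
proof (induction ms arbitrary: z)
  case Nil
  then show ?case by (simp add: dual_prod_def lookup_mon)
next
  case (Cons m ms)
  have prod_Cons: "dual_prod \<epsilon> \<Delta> (map dual (m # ms)) z = (\<Sum>u\<in>Poly_Mapping.keys (\<Delta> z).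
      Poly_Mapping.lookup (\<Delta> z) u * (dual m (mon (fst u)) * dual_prod \<epsilon> \<Delta> (map dual ms) (mon (snd u))))"
    by (simp add: dual_prod_def dual_mult_def dual_tensor_eq_sum)
  show ?case
  proof (cases ms)
    case Nil
    \<comment> \<open>The innermost factor of \<open>foldr\<close> is \<epsilon>, so a single
      functional still meets a coproduct, while the 1-fold \<open>iter_comult\<close> is the
      identity; the counit axiom reconciles them.\<close>
    have "dual_prod \<epsilon> \<Delta> (map dual (m # ms)) z
        = Poly_Mapping.lookup (lin_ext (\<lambda>(p, q). if q = {#} then mon [p] else 0) (\<Delta> z)) [m]"
      unfolding prod_Cons lookup_lin_ext
      by (intro sum.cong) (auto simp: Nil dual_prod_def counit_mon dual_mon lookup_mon split: if_splits)
    then show ?thesis by (simp add: lin_ext_counit_right Nil)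
  next
    case (Cons m' ms')
    have lk: "Poly_Mapping.lookup (lin_ext (\<lambda>ns. mon (p # ns)) x) (m # ms)
        = (if m = p then Poly_Mapping.lookup x ms else 0)" for p and x :: "_ \<Rightarrow>\<^sub>0 'k"
    proof -
      have "Poly_Mapping.lookup (lin_ext (\<lambda>ns. mon (p # ns)) x) (m # ms)
          = (\<Sum>ns\<in>Poly_Mapping.keys x. if ns = ms then (if m = p then Poly_Mapping.lookup x ms else 0) else 0)"
        unfolding lookup_lin_ext by (intro sum.cong) (auto simp: lookup_mon)
      then show ?thesis by (simp add: in_keys_iff)
    qed
    obtain k where k: "length ms = Suc k" using Cons by simp
    have "iter_comult \<epsilon> \<Delta> (length (m # ms)) z = lin_ext (\<lambda>(p, q).
        lin_ext (\<lambda>ns. mon (p # ns)) (iter_comult \<epsilon> \<Delta> (length ms) (mon q))) (\<Delta> z)"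
      by (simp only: length_Cons k iter_comult_Suc_Suc[OF linear_comult])
    then have "Poly_Mapping.lookup (iter_comult \<epsilon> \<Delta> (length (m # ms)) z) (m # ms)
        = (\<Sum>u\<in>Poly_Mapping.keys (\<Delta> z). Poly_Mapping.lookup (\<Delta> z) u *
            (if m = fst u then Poly_Mapping.lookup (iter_comult \<epsilon> \<Delta> (length ms) (mon (snd u))) ms else 0))"
      by (simp only: lookup_lin_ext[of _ "\<Delta> z"] case_prod_unfold lk)
    also have "\<dots> = dual_prod \<epsilon> \<Delta> (map dual (m # ms)) z"
      unfolding prod_Cons Cons.IH by (intro sum.cong) (auto simp: dual_mon)
    finally show ?thesis ..
  qed
qed

text \<open>Sort the words by first letter c and follow the recursion of \<open>xi\<close>: the rest
  is a word of content \<open>b - {#c#}\<close>, and commutative multiplication collects all words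
  at the monomial b.\<close>

lemma sum_dual_prod_eq_lookup_xi:
  "(\<Sum>w\<in>permutations_of_multiset b. dual_prod \<epsilon> \<Delta> (map (\<lambda>c. dual {#c#}) w) z)
    = Poly_Mapping.lookup (xi (size b) z) b"
proof (induction "size b" arbitrary: b z)
  case 0
  then show ?case by (simp add: dual_prod_def flip: mon_zero) (simp add: lookup_mon)
next
  case (Suc n)
  let ?d = "\<lambda>w. dual_prod \<epsilon> \<Delta> (map (\<lambda>c. dual {#c#}) w)"
  let ?L = "Poly_Mapping.lookup (\<Delta> z)" and ?K = "Poly_Mapping.keys (\<Delta> z)"
  from Suc.hyps(2) have b: "b \<noteq> {#}" by auto
  have "(\<Sum>w\<in>permutations_of_multiset b. ?d w z)
      = (\<Sum>c\<in>set_mset b. \<Sum>w\<in>permutations_of_multiset (b - {#c#}). ?d (c # w) z)"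
    unfolding permutations_of_multiset_nonempty[OF b]
    by (subst sum.UNION_disjoint) (auto simp: sum.reindex)
  also have "\<dots> = (\<Sum>c\<in>set_mset b. \<Sum>w\<in>permutations_of_multiset (b - {#c#}). \<Sum>u\<in>?K.
      ?L u * (dual {#c#} (mon (fst u)) * ?d w (mon (snd u))))"
    by (simp add: dual_prod_def dual_mult_def dual_tensor_eq_sum)
  also have "\<dots> = (\<Sum>c\<in>set_mset b. \<Sum>u\<in>?K. ?L u * (dual {#c#} (mon (fst u)) *
      (\<Sum>w\<in>permutations_of_multiset (b - {#c#}). ?d w (mon (snd u)))))"
    by (subst sum.swap) (simp only: sum_distrib_left)
  also have "\<dots> = (\<Sum>c\<in>set_mset b. \<Sum>u\<in>?K. ?L u * (dual {#c#} (mon (fst u)) *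
      Poly_Mapping.lookup (xi n (mon (snd u))) (b - {#c#})))"
  proof (intro sum.cong refl)
    fix c u assume "c \<in># b"
    then have "n = size (b - {#c#})" using Suc.hyps(2) by (simp add: size_Diff_singleton)
    then show "?L u * (dual {#c#} (mon (fst u)) *
        (\<Sum>w\<in>permutations_of_multiset (b - {#c#}). ?d w (mon (snd u))))
      = ?L u * (dual {#c#} (mon (fst u)) * Poly_Mapping.lookup (xi n (mon (snd u))) (b - {#c#}))"
      using Suc.hyps(1)[of "b - {#c#}" "mon (snd u)"] by simp
  qed
  also have "\<dots> = (\<Sum>u\<in>?K. ?L u * Poly_Mapping.lookup (prim (fst u) * xi n (mon (snd u))) b)"
    by (subst sum.swap) (simp only: sum_distrib_left lookup_prim_mult)
  also have "\<dots> = Poly_Mapping.lookup (xi (size b) z) b"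
    by (simp add: lookup_lin_ext case_prod_unfold flip: Suc.hyps(2))
  finally show ?case .
qed

end

section \<open>The functionals \<open>f\<^sub>b\<close>: duality, eigenvalues and expansions\<close>

context graded_connected_polynomial_hopf_char_0
begin

text \<open>The number of permutations giving the same word cancels the inverse factorials of the
  multiplicities in \<open>f_coeff\<close>.\<close>

lemma f_elt_eq:
  "f_elt \<epsilon> \<Delta> cs z = Poly_Mapping.lookup (xi (length cs) z) (mset cs) / fact (length cs)"
proof -
  let ?N = "\<Prod>c\<in>set_mset (mset cs). fact (count (mset cs) c) :: 'k"
  have "f_elt \<epsilon> \<Delta> cs z = f_coeff (mset cs) *
      (\<Sum>\<sigma> | \<sigma> permutes {..<length cs}. dual_prod \<epsilon> \<Delta> (map (\<lambda>c. dual {#c#}) (permute_list \<sigma> cs)) z)"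
    by (simp add: f_elt_def fscale_def sum_fun_apply permute_list_def o_def)
  also have "\<dots> = f_coeff (mset cs) * (of_nat (\<Prod>c\<in>set_mset (mset cs). fact (count (mset cs) c)) *
      Poly_Mapping.lookup (xi (length cs) z) (mset cs))"
    by (simp only: sum_permute_list[of "\<lambda>w. dual_prod \<epsilon> \<Delta> (map (\<lambda>c. dual {#c#}) w) z"] sum_dual_prod_eq_lookup_xi size_mset)
  also have "of_nat (\<Prod>c\<in>set_mset (mset cs). fact (count (mset cs) c)) = ?N"
    by simp
  also have "f_coeff (mset cs) = 1 / (?N * fact (length cs))"
    by (simp add: f_coeff_def field_simps)
  finally show ?thesis by simp
qed

text \<open>This is \<open>f\<^sub>b\<close> indexed by the monomial, with no chosen order of its
  factors; \<open>f_elt_eq\<close> is the link.\<close>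

definition f_val :: "'g multiset \<Rightarrow> ('g, 'k) pol \<Rightarrow> 'k" where
  "f_val b z = Poly_Mapping.lookup (xi (size b) z) b / fact (size b)"

lemma linear_f_val: "Vector_Spaces.linear scale (*) (f_val b)"
  by (rule linear_functionalI)
    (simp_all only: f_val_def xi_add xi_scale lookup_add add_divide_distrib lookup_scale
      times_divide_eq_right)

lemma f_val_scale: "f_val b (scale a x) = a * f_val b x"
  and f_val_zero: "f_val b 0 = 0"
  and f_val_diff: "f_val b (x - y) = f_val b x - f_val b y"
  and f_val_sum: "f_val b (\<Sum>i\<in>I. h i) = (\<Sum>i\<in>I. f_val b (h i))"
proof -
  interpret Vector_Spaces.linear scale "(*)" "f_val b" by (rule linear_f_val)
  show "f_val b (scale a x) = a * f_val b x" "f_val b 0 = 0" "f_val b (x - y) = f_val b x - f_val b y"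
    "f_val b (\<Sum>i\<in>I. h i) = (\<Sum>i\<in>I. f_val b (h i))"
    by (rule scale zero diff sum)+
qed

lemma f_val_mon: "size b \<le> size m \<Longrightarrow> f_val b (mon m) = (if m = b then 1 else 0)"
  by (simp add: f_val_def xi_mon lookup_mon del: xi.simps)

lemma f_val_g_elt: "f_val b (g_elt \<epsilon> \<Delta> m) = (if m = b then 1 else 0)"
  by (simp add: f_val_def xi_g_elt lookup_mon del: xi.simps)

text \<open>Coefficients in \<open>dependent_explicit\<close> are indexed by vectors rather than
  monomials, so the independence proofs use injectivity. The pairing with \<open>f\<^sub>b\<close>
  provides it.\<close>

lemma g_elt_eq_iff: "g_elt \<epsilon> \<Delta> b = g_elt \<epsilon> \<Delta> b' \<longleftrightarrow> b = b'"
  by (metis f_val_g_elt zero_neq_one)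

lemma f_val_eq_iff: "f_val b = f_val b' \<longleftrightarrow> b = b'"
  by (metis f_val_g_elt zero_neq_one)

lemma f_val_Psi: "f_val b (Psi \<epsilon> \<Delta> (Suc a) z) = of_nat (Suc a) ^ size b * f_val b z"
  by (simp add: f_val_def xi_Psi del: xi.simps)

lemma f_val_mon_wt: "f_val b (mon m) \<noteq> 0 \<Longrightarrow> wt deg m = wt deg b"
  using wt_keys_xi[of b "size b" m] by (simp add: f_val_def in_keys_iff)

text \<open>Unitriangularity: \<open>f\<^sub>b\<close> vanishes on every other monomial at least as
  long as b, and x has no shorter ones.\<close>

lemma f_val_eq_lookup:
  assumes "\<And>m. size m < size b \<Longrightarrow> Poly_Mapping.lookup x m = 0"
  shows "f_val b x = Poly_Mapping.lookup x b"
proof -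
  have "f_val b x = (\<Sum>m\<in>Poly_Mapping.keys x. if m = b then Poly_Mapping.lookup x m else 0)"
    unfolding linear_functional_eq_sum[OF linear_f_val, of b x]
  proof (rule sum.cong)
    fix m assume "m \<in> Poly_Mapping.keys x"
    then have "size b \<le> size m" using assms by (force simp: in_keys_iff not_less)
    then show "Poly_Mapping.lookup x m * f_val b (mon m) = (if m = b then Poly_Mapping.lookup x m else 0)"
      by (simp add: f_val_mon)
  qed simp
  then show ?thesis by (simp add: in_keys_iff)
qed

text \<open>Read off coefficients in order of length: once the shorter ones vanish,
  \<open>f\<^sub>m\<close> returns the coefficient of m.\<close>

lemma f_val_separates:
  assumes "\<And>b. f_val b x = 0"
  shows "x = 0"
proof (rule poly_mapping_eqI)
  fix m
  show "Poly_Mapping.lookup x m = Poly_Mapping.lookup 0 m"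
  proof (induction m rule: measure_induct_rule[of size])
    case (less m)
    then show ?case using assms[of m] by (simp add: f_val_eq_lookup)
  qed
qed

text \<open>Unitriangularity passes to the dual family: \<open>g\<^sub>b\<close> is b plus strictly
  longer monomials.\<close>

lemma lookup_g_elt:
  "size m \<le> size b \<Longrightarrow> Poly_Mapping.lookup (g_elt \<epsilon> \<Delta> b) m = (if m = b then 1 else 0)"
proof (induction m rule: measure_induct_rule[of size])
  case (less m)
  have "f_val m (g_elt \<epsilon> \<Delta> b) = Poly_Mapping.lookup (g_elt \<epsilon> \<Delta> b) m"
    using less by (intro f_val_eq_lookup) auto
  then show ?case by (auto simp: f_val_g_elt)
qed

text \<open>Both sides pair equally with every \<open>f\<^sub>b\<close>. As S need only contain the
  support, a whole degree can serve as S.\<close>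

lemma expand_g_elt:
  assumes "finite S" "\<And>m. f_val m x \<noteq> 0 \<Longrightarrow> m \<in> S"
  shows "x = (\<Sum>m\<in>S. scale (f_val m x) (g_elt \<epsilon> \<Delta> m))"
proof -
  have "f_val b (x - (\<Sum>m\<in>S. scale (f_val m x) (g_elt \<epsilon> \<Delta> m))) = 0" for b
  proof -
    have "f_val b (\<Sum>m\<in>S. scale (f_val m x) (g_elt \<epsilon> \<Delta> m)) = (\<Sum>m\<in>S. if m = b then f_val m x else 0)"
      by (simp add: f_val_sum f_val_scale f_val_g_elt) (intro sum.cong, auto)
    also have "\<dots> = f_val b x" using assms by auto
    finally show ?thesis by (simp add: f_val_diff)
  qed
  then have "x - (\<Sum>m\<in>S. scale (f_val m x) (g_elt \<epsilon> \<Delta> m)) = 0" by (rule f_val_separates)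
  then show ?thesis by simp
qed

text \<open>The coefficient of \<open>b\<close> in \<open>\<Psi>\<^sup>a(b')\<close> is a polynomial in \<open>a\<close> whose \<open>a\<^sup>l\<^sup>(\<^sup>b\<^sup>)\<close>-coefficient
  is \<open>f\<^sub>b(b')\<close>.\<close>

lemma arrow_if_f_val_nonzero:
  assumes "f_val b (mon b') \<noteq> 0"
  shows "arrow \<epsilon> \<Delta> b' b"
proof (rule ccontr)
  assume no: "\<not> arrow \<epsilon> \<Delta> b' b"
  define S where "S = {m. wt deg m = wt deg b'}"
  \<comment> \<open>Expanding \<open>\<Psi>\<^sup>a(b')\<close> in the \<open>g\<^sub>m\<close>, its
    coefficient at b is the sum of the \<open>C m * of_nat a ^ size m\<close>; \<open>p\<close> is
    this sum as a polynomial in a.\<close>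
  define C where "C m = f_val m (mon b') * Poly_Mapping.lookup (g_elt \<epsilon> \<Delta> m) b" for m
  define p where "p = (\<Sum>m\<in>S. Polynomial.monom (C m) (size m))"
  have S: "finite S" "m \<in> S" if "f_val m (mon b') \<noteq> 0" for m
    using finite_wt f_val_mon_wt[OF that] by (auto simp: S_def)
  have "b \<in> S" and fin: "finite S" using S assms by blast+
  have root: "poly p (of_nat (Suc a)) = 0" for a
  proof -
    have "Psi \<epsilon> \<Delta> (Suc a) (mon b')
        = (\<Sum>m\<in>S. scale (f_val m (Psi \<epsilon> \<Delta> (Suc a) (mon b'))) (g_elt \<epsilon> \<Delta> m))"
      using fin S(2) by (intro expand_g_elt) (auto simp: f_val_Psi)
    then have "Poly_Mapping.lookup (Psi \<epsilon> \<Delta> (Suc a) (mon b')) b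
        = Poly_Mapping.lookup (\<Sum>m\<in>S. scale (f_val m (Psi \<epsilon> \<Delta> (Suc a) (mon b'))) (g_elt \<epsilon> \<Delta> m)) b"
      by (rule arg_cong)
    also have "\<dots> = poly p (of_nat (Suc a))"
      by (simp add: p_def lookup_sum f_val_Psi poly_sum poly_monom C_def mult_ac del: of_nat_Suc)
    finally show ?thesis using no unfolding arrow_def by (metis zero_less_Suc)
  qed
  \<comment> \<open>Without an arrow \<open>p\<close> vanishes at every positive integer, and in
    characteristic zero these are infinitely many roots.\<close>
  have "infinite (range (\<lambda>a. of_nat (Suc a) :: 'k))"
    by (rule range_inj_infinite) (auto intro: injI simp del: of_nat_Suc)
  moreover have "range (\<lambda>a. of_nat (Suc a)) \<subseteq> {x. poly p x = 0}" using root by blast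
  ultimately have "p = 0" using poly_roots_finite finite_subset by blast
  then have "0 = coeff p (size b)" by simp
  also have "\<dots> = (\<Sum>m\<in>S. if size m = size b then C m else 0)"
    by (simp add: p_def coeff_sum)
  \<comment> \<open>Among the \<open>g\<^sub>m\<close> with m as long as b, only
    \<open>g\<^sub>b\<close> contains b, with coefficient 1.\<close>
  also have "\<dots> = (\<Sum>m\<in>S. if m = b then f_val m (mon b') else 0)"
    by (intro sum.cong) (auto simp: C_def lookup_g_elt)
  also have "\<dots> = f_val b (mon b')" using fin \<open>b \<in> S\<close> by simp
  finally show False using assms by simp
qed

text \<open>Covers both expansions of the theorem: A may be any finite set without b that contains
  the rest of the support.\<close>

lemma f_val_expand_dual:
  assumes "finite A" "b \<notin> A" "\<And>m. f_val b (mon m) \<noteq> 0 \<Longrightarrow> m \<noteq> b \<Longrightarrow> m \<in> A"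
  shows "f_val b = dual b + (\<Sum>m\<in>A. fscale (f_val b (mon m)) (dual m))"
proof (rule ext)
  fix z
  have "f_val b z = (\<Sum>m\<in>insert b A. f_val b (mon m) * dual m z)"
    unfolding linear_functional_eq_sum[OF linear_f_val, of b z]
    using assms by (intro sum.mono_neutral_cong) (auto simp: dual_def in_keys_iff)
  also have "\<dots> = dual b z + (\<Sum>m\<in>A. f_val b (mon m) * dual m z)"
    using assms by (simp add: f_val_mon)
  finally show "f_val b z = (dual b + (\<Sum>m\<in>A. fscale (f_val b (mon m)) (dual m))) z"
    by (simp add: sum_fun_apply fscale_def)
qed

lemma f_val_in_graded_dual: "f_val b \<in> graded_dual deg"
proof -
  have "n = wt deg b" if "x \<in> homog deg n" "f_val b x \<noteq> 0" for n x
  proof (rule ccontr)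
    assume n: "n \<noteq> wt deg b"
    have "f_val b x = 0"
      unfolding linear_functional_eq_sum[OF linear_f_val, of b x]
      using n that(1) f_val_mon_wt by (intro sum.neutral) (fastforce simp: homog_def)
    with that(2) show False by simp
  qed
  then have "{n. \<exists>x\<in>homog deg n. f_val b x \<noteq> 0} \<subseteq> {wt deg b}" by blast
  then show ?thesis using linear_f_val by (auto simp: graded_dual_def intro: finite_subset)
qed

lemma finite_arrow: "finite {b'. arrow \<epsilon> \<Delta> b' b}"
proof -
  have "{b'. arrow \<epsilon> \<Delta> b' b} \<subseteq> {m. wt deg m = wt deg b}"
  proof clarify
    fix b' assume "arrow \<epsilon> \<Delta> b' b"
    then obtain a where "a > 0" "b \<in> Poly_Mapping.keys (Psi \<epsilon> \<Delta> a (mon b'))"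
      by (auto simp: arrow_def in_keys_iff)
    then show "wt deg b' = wt deg b" using wt_keys_Psi by (cases a) auto
  qed
  then show ?thesis using finite_wt by (rule finite_subset)
qed

lemma finite_f_val_mon: "finite {m. f_val b (mon m) \<noteq> 0}"
  by (rule finite_subset[OF _ finite_wt[of "wt deg b"]]) (auto dest: f_val_mon_wt)

lemma f_val_expand_arrow:
  "f_val b = dual b + (\<Sum>m | arrow \<epsilon> \<Delta> m b \<and> m \<noteq> b. fscale (f_val b (mon m)) (dual m))"
  by (rule f_val_expand_dual)
    (auto intro: arrow_if_f_val_nonzero finite_subset[OF _ finite_arrow[of b]])

text \<open>There may be infinitely many shorter monomials, and a sum over an infinite set is 0 by
  convention; hence the restriction to nonzero coefficients.\<close>

lemma f_val_expand_size:
  "f_val b = dual b +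
    (\<Sum>m | size m < size b \<and> f_val b (mon m) \<noteq> 0. fscale (f_val b (mon m)) (dual m))"
proof (rule f_val_expand_dual)
  fix m assume "f_val b (mon m) \<noteq> 0" "m \<noteq> b"
  then show "m \<in> {m. size m < size b \<and> f_val b (mon m) \<noteq> 0}"
    using f_val_mon[of b m] by (cases "size b \<le> size m") auto
qed (auto intro: finite_subset[OF _ finite_f_val_mon[of b]])

section \<open>The two families as bases of H and of its graded dual\<close>

lemma independent_g_elt: "pm.independent (range (g_elt \<epsilon> \<Delta>))"
proof
  assume "pm.dependent (range (g_elt \<epsilon> \<Delta>))"
  then obtain t u b where t: "finite t" "t \<subseteq> range (g_elt \<epsilon> \<Delta>)"
    and s: "(\<Sum>v\<in>t. scale (u v) v) = 0" and b: "g_elt \<epsilon> \<Delta> b \<in> t" "u (g_elt \<epsilon> \<Delta> b) \<noteq> 0"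
    unfolding pm.dependent_explicit by blast
  have "0 = f_val b (\<Sum>v\<in>t. scale (u v) v)" using s by (simp add: f_val_zero)
  also have "\<dots> = (\<Sum>v\<in>t. u v * f_val b v)" by (simp add: f_val_sum f_val_scale)
  also have "\<dots> = (\<Sum>v\<in>t. if v = g_elt \<epsilon> \<Delta> b then u v else 0)"
  proof (rule sum.cong)
    fix v assume "v \<in> t"
    then obtain b' where "v = g_elt \<epsilon> \<Delta> b'" using t(2) by blast
    then show "u v * f_val b v = (if v = g_elt \<epsilon> \<Delta> b then u v else 0)"
      by (simp add: f_val_g_elt g_elt_eq_iff f_val_eq_iff)
  qed simp
  also have "\<dots> = u (g_elt \<epsilon> \<Delta> b)" using t(1) b(1) by simp
  finally show False using b(2) by simp
qed

lemma independent_f_val: "fn.independent (range f_val)"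
proof
  assume "fn.dependent (range f_val)"
  then obtain t u b where t: "finite t" "t \<subseteq> range f_val"
    and s: "(\<Sum>v\<in>t. fscale (u v) v) = 0" and b: "f_val b \<in> t" "u (f_val b) \<noteq> 0"
    unfolding fn.dependent_explicit by blast
  have "0 = (\<Sum>v\<in>t. fscale (u v) v) (g_elt \<epsilon> \<Delta> b)" using s by simp
  also have "\<dots> = (\<Sum>v\<in>t. u v * v (g_elt \<epsilon> \<Delta> b))" by (simp add: sum_fun_apply fscale_def)
  also have "\<dots> = (\<Sum>v\<in>t. if v = f_val b then u v else 0)"
  proof (rule sum.cong)
    fix v assume "v \<in> t"
    then obtain b' where "v = f_val b'" using t(2) by blast
    then show "u v * v (g_elt \<epsilon> \<Delta> b) = (if v = f_val b then u v else 0)"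
      by (simp add: f_val_g_elt g_elt_eq_iff f_val_eq_iff)
  qed simp
  also have "\<dots> = u (f_val b)" using t(1) b(1) by simp
  finally show False using b(2) by simp
qed

lemma span_g_elt: "pm.span (range (g_elt \<epsilon> \<Delta>)) = UNIV"
proof -
  have mon: "mon m \<in> pm.span (range (g_elt \<epsilon> \<Delta>))" for m
  proof -
    have "mon m = (\<Sum>b | wt deg b = wt deg m. scale (f_val b (mon m)) (g_elt \<epsilon> \<Delta> b))"
      by (rule expand_g_elt) (auto simp: finite_wt dest: f_val_mon_wt)
    also have "\<dots> \<in> pm.span (range (g_elt \<epsilon> \<Delta>))"
      by (intro pm.span_sum pm.span_scale pm.span_base) auto
    finally show ?thesis .
  qed
  have "x \<in> pm.span (range (g_elt \<epsilon> \<Delta>))" for x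
    by (subst expand_mon) (intro pm.span_sum pm.span_scale mon)
  then show ?thesis by blast
qed

text \<open>Inverts the unitriangular system: solve the expansion over shorter monomials for
  \<open>dual b\<close> and induct on length.\<close>

lemma dual_in_span_f_val: "dual b \<in> fn.span (range f_val)"
proof (induction b rule: measure_induct_rule[of size])
  case (less b)
  let ?s = "\<Sum>m | size m < size b \<and> f_val b (mon m) \<noteq> 0. fscale (f_val b (mon m)) (dual m)"
  have "?s \<in> fn.span (range f_val)"
    using less by (intro fn.span_sum fn.span_scale) auto
  moreover have "dual b = f_val b - ?s"
    unfolding eq_diff_eq by (rule f_val_expand_size[symmetric])
  moreover have "f_val b \<in> fn.span (range f_val)" by (intro fn.span_base rangeI)
  ultimately show ?case by (simp only: fn.span_diff)
qed

lemma span_f_val: "fn.span (range f_val) = graded_dual deg"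
proof
  show "fn.span (range f_val) \<subseteq> graded_dual deg"
    using f_val_in_graded_dual subspace_graded_dual by (intro fn.span_minimal) auto
next
  show "graded_dual deg \<subseteq> fn.span (range f_val)"
  proof
    fix \<phi> :: "('g, 'k) pol \<Rightarrow> 'k" assume \<phi>: "\<phi> \<in> graded_dual deg"
    \<comment> \<open>The monomials in the finitely many degrees on which \<open>\<phi>\<close> does
      not vanish; each degree contains finitely many.\<close>
    define S where "S = (\<Union>n\<in>{n. \<exists>x\<in>homog deg n. \<phi> x \<noteq> 0}. {m. wt deg m = n})"
    from \<phi> have lin: "Vector_Spaces.linear scale (*) \<phi>" and fin: "finite S"
      by (auto simp: graded_dual_def S_def finite_wt)
    have S: "m \<in> S" if "\<phi> (mon m) \<noteq> 0" for m
    proof -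
      have "mon m \<in> homog deg (wt deg m)" by (simp add: homog_def)
      with that show ?thesis by (auto simp: S_def)
    qed
    have "\<phi> = (\<Sum>m\<in>S. fscale (\<phi> (mon m)) (dual m))"
    proof (rule ext)
      fix z
      have "\<phi> z = (\<Sum>m\<in>S. \<phi> (mon m) * dual m z)"
        unfolding linear_functional_eq_sum[OF lin, of z]
        using fin S by (intro sum.mono_neutral_cong) (auto simp: dual_def in_keys_iff)
      then show "\<phi> z = (\<Sum>m\<in>S. fscale (\<phi> (mon m)) (dual m)) z"
        by (simp add: sum_fun_apply fscale_def)
    qed
    also have "\<dots> \<in> fn.span (range f_val)"
      by (intro fn.span_sum fn.span_scale dual_in_span_f_val)
    finally show "\<phi> \<in> fn.span (range f_val)" .
  qed
qed

end

theorem theorem3p18: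
  fixes deg :: "'g \<Rightarrow> nat"
    and \<Delta> :: "('g, 'k::field_char_0) pol \<Rightarrow> ('g, 'k) pol2"
    and \<epsilon> :: "('g, 'k) pol \<Rightarrow> 'k"
    and antipode :: "('g, 'k) pol \<Rightarrow> ('g, 'k) pol"
    and factors :: "'g multiset \<Rightarrow> 'g list"
    and f :: "'g multiset \<Rightarrow> ('g, 'k) pol \<Rightarrow> 'k"
    and g :: "'g multiset \<Rightarrow> ('g, 'k) pol"
  assumes hopf: "graded_connected_polynomial_hopf deg \<Delta> \<epsilon> antipode"
    and factors: "\<And>b. mset (factors b) = b"
    and f_def: "\<And>b. f b = f_elt \<epsilon> \<Delta> (factors b)"
    and g_def: "\<And>b. g b = g_elt \<epsilon> \<Delta> b"
  shows
    "(\<forall>b.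
        f b \<in> graded_dual deg \<and>
        (\<forall>a>0. f b \<noteq> 0 \<and> Psi_dual \<epsilon> \<Delta> a (f b) = fscale (of_nat a ^ size b) (f b)) \<and>
        (\<forall>b'. f b (mon b') =
           f_coeff b *
           (\<Sum>\<sigma> | \<sigma> permutes {..<size b}.
              Poly_Mapping.lookup (iter_comult \<epsilon> \<Delta> (size b) (mon b'))
                (map (\<lambda>i. {#factors b ! \<sigma> i#}) [0..<size b]))) \<and>
        finite {b'. arrow \<epsilon> \<Delta> b' b \<and> b' \<noteq> b} \<and>
        f b = dual b +
          (\<Sum>b' | arrow \<epsilon> \<Delta> b' b \<and> b' \<noteq> b. fscale (f b (mon b')) (dual b')) \<and>
        finite {b'. size b' < size b \<and> f b (mon b') \<noteq> 0} \<and>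
        f b = dual b +
          (\<Sum>b' | size b' < size b \<and> f b (mon b') \<noteq> 0. fscale (f b (mon b')) (dual b'))) \<and>
     (\<forall>b b'. b \<noteq> b' \<longrightarrow> f b (g b') = 0) \<and>
     (\<forall>b. f b (g b) = 1) \<and>
     pm.independent (range g) \<and> pm.span (range g) = UNIV \<and>
     fn.independent (range f) \<and> fn.span (range f) = graded_dual deg"
proof -
  interpret H: graded_connected_polynomial_hopf_char_0 deg \<Delta> \<epsilon> antipode
    using hopf by (rule graded_connected_polynomial_hopf_char_0.intro)
  have len: "length (factors b) = size b" for b
    using factors[of b] by (metis size_mset)
  \<comment> \<open>The listing chosen by \<open>factors\<close> does not affect the
    functional.\<close>
  have f: "f = H.f_val"
    by (intro ext) (simp add: f_def H.f_elt_eq H.f_val_def factors len del: H.xi.simps)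
  have g: "g = g_elt \<epsilon> \<Delta>" using g_def by blast
  have nonzero: "f b \<noteq> 0" for b
    using H.f_val_g_elt[of b b] by (auto simp: f)
  have eigen: "Psi_dual \<epsilon> \<Delta> a (f b) = fscale (of_nat a ^ size b) (f b)" if "a > 0" for a b
    using that by (cases a) (auto simp: Psi_dual_def fscale_def f H.f_val_Psi simp del: of_nat_Suc)
  \<comment> \<open>The coefficient formula is read off the defining sum over permutations, term by
    term, rather than off \<xi>.\<close>
  have "dual_prod \<epsilon> \<Delta> (map (\<lambda>i. dual {#factors b ! \<sigma> i#}) [0..<size b]) z
      = Poly_Mapping.lookup (iter_comult \<epsilon> \<Delta> (size b) z) (map (\<lambda>i. {#factors b ! \<sigma> i#}) [0..<size b])"
    for b \<sigma> z
    using H.dual_prod_dual[of "map (\<lambda>i. {#factors b ! \<sigma> i#}) [0..<size b]" z] by (simp add: o_def)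
  then have coeff: "f b (mon b') = f_coeff b * (\<Sum>\<sigma> | \<sigma> permutes {..<size b}.
      Poly_Mapping.lookup (iter_comult \<epsilon> \<Delta> (size b) (mon b'))
        (map (\<lambda>i. {#factors b ! \<sigma> i#}) [0..<size b]))" for b b'
    unfolding f_def f_elt_def factors len
    by (simp only: fscale_def sum_fun_apply)
  have fin1: "finite {b'. arrow \<epsilon> \<Delta> b' b \<and> b' \<noteq> b}" for b
    by (rule finite_subset[OF _ H.finite_arrow[of b]]) auto
  have fin2: "finite {b'. size b' < size b \<and> f b (mon b') \<noteq> 0}" for b
    unfolding f by (rule finite_subset[OF _ H.finite_f_val_mon[of b]]) auto
  have mem: "f b \<in> graded_dual deg" for b
    unfolding f by (rule H.f_val_in_graded_dual)
  have expand1: "f b = dual b +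
      (\<Sum>b' | arrow \<epsilon> \<Delta> b' b \<and> b' \<noteq> b. fscale (f b (mon b')) (dual b'))" for b
    unfolding f by (rule H.f_val_expand_arrow)
  have expand2: "f b = dual b +
      (\<Sum>b' | size b' < size b \<and> f b (mon b') \<noteq> 0. fscale (f b (mon b')) (dual b'))" for b
    unfolding f by (rule H.f_val_expand_size)
  have dual0: "f b (g b') = 0" if "b \<noteq> b'" for b b'
    using that by (simp add: f g H.f_val_g_elt)
  have dual1: "f b (g b) = 1" for b
    by (simp add: f g H.f_val_g_elt)
  have bases: "pm.independent (range g)" "pm.span (range g) = UNIV"
    "fn.independent (range f)" "fn.span (range f) = graded_dual deg"
    unfolding f g
    by (rule H.independent_g_elt H.span_g_elt H.independent_f_val H.span_f_val)+
  show ?thesis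
    by (intro conjI allI impI)
      (rule mem nonzero eigen coeff fin1 expand1 fin2 expand2 dual0 dual1 bases; assumption)+
qed

end
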